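(* For finite groups, the following numbers are not monoidal Morita invariants: (1) the total number of subgroups of a group; (2) the number of subgroups of a given isomorphism type of a group. That is: (1) there exist isocategorical finite groups $G_1,G_2$ with different total numbers of subgroups; and (2) there exist isocategorical finite groups $G_1,G_2$ and a finite group $L$ such that the number of subgroups of $G_1$ isomorphic to $L$ differs from the number of subgroups of $G_2$ isomorphic to $L$.
   Context: Two finite groups $G_1,G_2$ are isocategorical if the categories $\mathrm{Rep}_{\mathbb C}(G_1)$ and $\mathrm{Rep}_{\mathbb C}(G_2)$ of finite-dimensional complex representations are equivalent as tensor (monoidal) categories, without regard to their symmetric structure. A numerical quantity attached to finite groups is a monoidal Morita invariant if it takes the same value on any two isocategorical groups. *)

theory Defs
  imports "Jordan_Normal_Form.Matrix"
begin

section \<open>Categories, functors and equivalences\<close>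

text \<open>
  Hom sets are not required to be disjoint: a single arrow value (below: a matrix) may be a
  morphism between several pairs of objects.  The action of a functor on arrows therefore takes
  the source and the target as additional arguments.
\<close>

record ('o, 'm) cat =
  Obj :: "'o set"
  Hom :: "'o \<Rightarrow> 'o \<Rightarrow> 'm set"
  Comp :: "'m \<Rightarrow> 'm \<Rightarrow> 'm" (infixl "\<star>\<index>" 70)
  Ident :: "'o \<Rightarrow> 'm"

locale category =
  fixes C :: "('o, 'm, 'x) cat_scheme" (structure)
  assumes id_hom: "a \<in> Obj C \<Longrightarrow> Ident C a \<in> Hom C a a"
    and comp_hom: "\<lbrakk>a \<in> Obj C; b \<in> Obj C; c \<in> Obj C; f \<in> Hom C a b; g \<in> Hom C b c\<rbrakk>
      \<Longrightarrow> g \<star> f \<in> Hom C a c"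
    and comp_id: "\<lbrakk>a \<in> Obj C; b \<in> Obj C; f \<in> Hom C a b\<rbrakk> \<Longrightarrow> f \<star> Ident C a = f"
    and id_comp: "\<lbrakk>a \<in> Obj C; b \<in> Obj C; f \<in> Hom C a b\<rbrakk> \<Longrightarrow> Ident C b \<star> f = f"
    and comp_assoc: "\<lbrakk>a \<in> Obj C; b \<in> Obj C; c \<in> Obj C; d \<in> Obj C;
        f \<in> Hom C a b; g \<in> Hom C b c; h \<in> Hom C c d\<rbrakk>
      \<Longrightarrow> (h \<star> g) \<star> f = h \<star> (g \<star> f)"

definition cat_iso :: "('o, 'm, 'x) cat_scheme \<Rightarrow> 'o \<Rightarrow> 'o \<Rightarrow> 'm \<Rightarrow> bool" where
  "cat_iso C a b f \<longleftrightarrow> f \<in> Hom C a b \<and>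
     (\<exists>g \<in> Hom C b a. g \<star>\<^bsub>C\<^esub> f = Ident C a \<and> f \<star>\<^bsub>C\<^esub> g = Ident C b)"

locale cat_functor = C: category C + D: category D
  for C :: "('o, 'm, 'x) cat_scheme" and D :: "('p, 'n, 'y) cat_scheme" +
  fixes F0 :: "'o \<Rightarrow> 'p" and F1 :: "'o \<Rightarrow> 'o \<Rightarrow> 'm \<Rightarrow> 'n"
  assumes obj_map: "a \<in> Obj C \<Longrightarrow> F0 a \<in> Obj D"
    and hom_map: "\<lbrakk>a \<in> Obj C; b \<in> Obj C; f \<in> Hom C a b\<rbrakk> \<Longrightarrow> F1 a b f \<in> Hom D (F0 a) (F0 b)"
    and id_map: "a \<in> Obj C \<Longrightarrow> F1 a a (Ident C a) = Ident D (F0 a)"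
    and comp_map: "\<lbrakk>a \<in> Obj C; b \<in> Obj C; c \<in> Obj C; f \<in> Hom C a b; g \<in> Hom C b c\<rbrakk>
      \<Longrightarrow> F1 a c (g \<star>\<^bsub>C\<^esub> f) = F1 b c g \<star>\<^bsub>D\<^esub> F1 a b f"

definition natural_iso ::
  "('o, 'm, 'x) cat_scheme \<Rightarrow> ('p, 'n, 'y) cat_scheme \<Rightarrow>
   ('o \<Rightarrow> 'p) \<Rightarrow> ('o \<Rightarrow> 'o \<Rightarrow> 'm \<Rightarrow> 'n) \<Rightarrow> ('o \<Rightarrow> 'p) \<Rightarrow> ('o \<Rightarrow> 'o \<Rightarrow> 'm \<Rightarrow> 'n) \<Rightarrow>
   ('o \<Rightarrow> 'n) \<Rightarrow> bool" where
  "natural_iso C D F0 F1 G0 G1 t \<longleftrightarrow>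
     (\<forall>a \<in> Obj C. cat_iso D (F0 a) (G0 a) (t a)) \<and>
     (\<forall>a \<in> Obj C. \<forall>b \<in> Obj C. \<forall>f \<in> Hom C a b.
        G1 a b f \<star>\<^bsub>D\<^esub> t a = t b \<star>\<^bsub>D\<^esub> F1 a b f)"

locale cat_equivalence = cat_functor C D F0 F1
  for C :: "('o, 'm, 'x) cat_scheme" and D :: "('p, 'n, 'y) cat_scheme"
    and F0 :: "'o \<Rightarrow> 'p" and F1 :: "'o \<Rightarrow> 'o \<Rightarrow> 'm \<Rightarrow> 'n" +
  assumes quasi_inverse: "\<exists>G0 G1 \<eta> \<epsilon>. cat_functor D C G0 G1 \<and>
      natural_iso C C (\<lambda>a. a) (\<lambda>a b f. f) (\<lambda>a. G0 (F0 a)) (\<lambda>a b f. G1 (F0 a) (F0 b) (F1 a b f)) \<eta> \<and>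
      natural_iso D D (\<lambda>a. F0 (G0 a)) (\<lambda>a b f. F1 (G0 a) (G0 b) (G1 a b f)) (\<lambda>a. a) (\<lambda>a b f. f) \<epsilon>"


section \<open>Monoidal categories and monoidal equivalences\<close>

record ('o, 'm) moncat = "('o, 'm) cat" +
  TenO :: "'o \<Rightarrow> 'o \<Rightarrow> 'o" (infixr "\<boxtimes>\<index>" 75)
  TenM :: "'m \<Rightarrow> 'm \<Rightarrow> 'm" (infixr "\<boxdot>\<index>" 75)
  Unit :: "'o"
  Assoc :: "'o \<Rightarrow> 'o \<Rightarrow> 'o \<Rightarrow> 'm"
  LUnit :: "'o \<Rightarrow> 'm"
  RUnit :: "'o \<Rightarrow> 'm"

locale monoidal_category = category C
  for C :: "('o, 'm, 'x) moncat_scheme" (structure) +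
  assumes ten_obj: "\<lbrakk>a \<in> Obj C; b \<in> Obj C\<rbrakk> \<Longrightarrow> a \<boxtimes> b \<in> Obj C"
    and ten_hom: "\<lbrakk>a \<in> Obj C; b \<in> Obj C; c \<in> Obj C; d \<in> Obj C; f \<in> Hom C a b; g \<in> Hom C c d\<rbrakk>
      \<Longrightarrow> f \<boxdot> g \<in> Hom C (a \<boxtimes> c) (b \<boxtimes> d)"
    and ten_id: "\<lbrakk>a \<in> Obj C; b \<in> Obj C\<rbrakk> \<Longrightarrow> Ident C a \<boxdot> Ident C b = Ident C (a \<boxtimes> b)"
    and ten_comp: "\<lbrakk>a \<in> Obj C; b \<in> Obj C; c \<in> Obj C; a' \<in> Obj C; b' \<in> Obj C; c' \<in> Obj C;
        f \<in> Hom C a b; g \<in> Hom C b c; f' \<in> Hom C a' b'; g' \<in> Hom C b' c'\<rbrakk>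
      \<Longrightarrow> (g \<star> f) \<boxdot> (g' \<star> f') = (g \<boxdot> g') \<star> (f \<boxdot> f')"
    and unit_obj: "Unit C \<in> Obj C"
    and assoc_iso: "\<lbrakk>a \<in> Obj C; b \<in> Obj C; c \<in> Obj C\<rbrakk>
      \<Longrightarrow> cat_iso C ((a \<boxtimes> b) \<boxtimes> c) (a \<boxtimes> (b \<boxtimes> c)) (Assoc C a b c)"
    and assoc_natural: "\<lbrakk>a \<in> Obj C; b \<in> Obj C; c \<in> Obj C; a' \<in> Obj C; b' \<in> Obj C; c' \<in> Obj C;
        f \<in> Hom C a a'; g \<in> Hom C b b'; h \<in> Hom C c c'\<rbrakk>
      \<Longrightarrow> Assoc C a' b' c' \<star> ((f \<boxdot> g) \<boxdot> h) = (f \<boxdot> (g \<boxdot> h)) \<star> Assoc C a b c"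
    and lunit_iso: "a \<in> Obj C \<Longrightarrow> cat_iso C (Unit C \<boxtimes> a) a (LUnit C a)"
    and lunit_natural: "\<lbrakk>a \<in> Obj C; b \<in> Obj C; f \<in> Hom C a b\<rbrakk>
      \<Longrightarrow> LUnit C b \<star> (Ident C (Unit C) \<boxdot> f) = f \<star> LUnit C a"
    and runit_iso: "a \<in> Obj C \<Longrightarrow> cat_iso C (a \<boxtimes> Unit C) a (RUnit C a)"
    and runit_natural: "\<lbrakk>a \<in> Obj C; b \<in> Obj C; f \<in> Hom C a b\<rbrakk>
      \<Longrightarrow> RUnit C b \<star> (f \<boxdot> Ident C (Unit C)) = f \<star> RUnit C a"
    and pentagon: "\<lbrakk>a \<in> Obj C; b \<in> Obj C; c \<in> Obj C; d \<in> Obj C\<rbrakk>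
      \<Longrightarrow> (Ident C a \<boxdot> Assoc C b c d) \<star> Assoc C a (b \<boxtimes> c) d \<star> (Assoc C a b c \<boxdot> Ident C d)
        = Assoc C a b (c \<boxtimes> d) \<star> Assoc C (a \<boxtimes> b) c d"
    and triangle: "\<lbrakk>a \<in> Obj C; b \<in> Obj C\<rbrakk>
      \<Longrightarrow> (Ident C a \<boxdot> LUnit C b) \<star> Assoc C a (Unit C) b = RUnit C a \<boxdot> Ident C b"

locale monoidal_functor = C: monoidal_category C + D: monoidal_category D + cat_functor C D F0 F1
  for C :: "('o, 'm, 'x) moncat_scheme" and D :: "('p, 'n, 'y) moncat_scheme"
    and F0 :: "'o \<Rightarrow> 'p" and F1 :: "'o \<Rightarrow> 'o \<Rightarrow> 'm \<Rightarrow> 'n" +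
  fixes J :: "'o \<Rightarrow> 'o \<Rightarrow> 'n" and u :: "'n"
  assumes J_iso: "\<lbrakk>a \<in> Obj C; b \<in> Obj C\<rbrakk>
      \<Longrightarrow> cat_iso D (F0 a \<boxtimes>\<^bsub>D\<^esub> F0 b) (F0 (a \<boxtimes>\<^bsub>C\<^esub> b)) (J a b)"
    and J_natural: "\<lbrakk>a \<in> Obj C; b \<in> Obj C; a' \<in> Obj C; b' \<in> Obj C;
        f \<in> Hom C a a'; g \<in> Hom C b b'\<rbrakk>
      \<Longrightarrow> F1 (a \<boxtimes>\<^bsub>C\<^esub> b) (a' \<boxtimes>\<^bsub>C\<^esub> b') (f \<boxdot>\<^bsub>C\<^esub> g) \<star>\<^bsub>D\<^esub> J a b
        = J a' b' \<star>\<^bsub>D\<^esub> (F1 a a' f \<boxdot>\<^bsub>D\<^esub> F1 b b' g)"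
    and u_iso: "cat_iso D (Unit D) (F0 (Unit C)) u"
    and J_assoc: "\<lbrakk>a \<in> Obj C; b \<in> Obj C; c \<in> Obj C\<rbrakk>
      \<Longrightarrow> F1 ((a \<boxtimes>\<^bsub>C\<^esub> b) \<boxtimes>\<^bsub>C\<^esub> c) (a \<boxtimes>\<^bsub>C\<^esub> (b \<boxtimes>\<^bsub>C\<^esub> c)) (Assoc C a b c)
          \<star>\<^bsub>D\<^esub> J (a \<boxtimes>\<^bsub>C\<^esub> b) c \<star>\<^bsub>D\<^esub> (J a b \<boxdot>\<^bsub>D\<^esub> Ident D (F0 c))
        = J a (b \<boxtimes>\<^bsub>C\<^esub> c) \<star>\<^bsub>D\<^esub> (Ident D (F0 a) \<boxdot>\<^bsub>D\<^esub> J b c)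
          \<star>\<^bsub>D\<^esub> Assoc D (F0 a) (F0 b) (F0 c)"
    and J_lunit: "a \<in> Obj C
      \<Longrightarrow> F1 (Unit C \<boxtimes>\<^bsub>C\<^esub> a) a (LUnit C a) \<star>\<^bsub>D\<^esub> J (Unit C) a \<star>\<^bsub>D\<^esub> (u \<boxdot>\<^bsub>D\<^esub> Ident D (F0 a))
        = LUnit D (F0 a)"
    and J_runit: "a \<in> Obj C
      \<Longrightarrow> F1 (a \<boxtimes>\<^bsub>C\<^esub> Unit C) a (RUnit C a) \<star>\<^bsub>D\<^esub> J a (Unit C) \<star>\<^bsub>D\<^esub> (Ident D (F0 a) \<boxdot>\<^bsub>D\<^esub> u)
        = RUnit D (F0 a)"

text \<open>The quasi-inverse of a monoidal functor that is an equivalence is automatically monoidal.\<close>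

locale monoidal_equivalence = monoidal_functor C D F0 F1 J u + cat_equivalence C D F0 F1
  for C :: "('o, 'm, 'x) moncat_scheme" and D :: "('p, 'n, 'y) moncat_scheme"
    and F0 :: "'o \<Rightarrow> 'p" and F1 :: "'o \<Rightarrow> 'o \<Rightarrow> 'm \<Rightarrow> 'n"
    and J :: "'o \<Rightarrow> 'o \<Rightarrow> 'n" and u :: "'n"


section \<open>The tensor category of finite-dimensional complex representations\<close>

definition kron :: "'a :: times mat \<Rightarrow> 'a mat \<Rightarrow> 'a mat" where
  "kron A B = mat (dim_row A * dim_row B) (dim_col A * dim_col B)
     (\<lambda>(i, j). A $$ (i div dim_row B, j div dim_col B) * B $$ (i mod dim_row B, j mod dim_col B))"

text \<open>
  The finite-dimensional vector spaces do not form a type, so every representation is given in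
  coordinates, on \<open>\<complex>\<^sup>n\<close> (\<open>n = 0\<close> included): a pair of its dimension \<open>n\<close> and a homomorphism from \<open>G\<close>
  to the invertible \<open>n \<times> n\<close> matrices, acting on column vectors.  Invertibility of \<open>\<rho> g\<close> follows
  from the two equations when \<open>G\<close> is a group.  Linear maps are matrices, composition is the matrix
  product, and the tensor product is the Kronecker product, with \<open>e\<^sub>i \<otimes> e\<^sub>j\<close> at index \<open>i * m + j\<close>
  when the second factor has dimension \<open>m\<close>.  In these bases the usual associativity and unit
  isomorphisms are identity matrices.  The values of \<open>\<rho>\<close> outside \<open>carrier G\<close> are irrelevant: two
  representations that agree on \<open>carrier G\<close> are isomorphic through the identity matrix.
\<close>

type_synonym 'a rep = "nat \<times> ('a \<Rightarrow> complex mat)"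

definition reps :: "('a, 'b) monoid_scheme \<Rightarrow> 'a rep set" where
  "reps G = {(n, \<rho>). (\<forall>g \<in> carrier G. \<rho> g \<in> carrier_mat n n) \<and> \<rho> \<one>\<^bsub>G\<^esub> = 1\<^sub>m n \<and>
     (\<forall>g \<in> carrier G. \<forall>h \<in> carrier G. \<rho> (g \<otimes>\<^bsub>G\<^esub> h) = \<rho> g * \<rho> h)}"

definition intertwiners ::
  "('a, 'b) monoid_scheme \<Rightarrow> 'a rep \<Rightarrow> 'a rep \<Rightarrow> complex mat set" where
  "intertwiners G V W = {T \<in> carrier_mat (fst W) (fst V).
     \<forall>g \<in> carrier G. T * snd V g = snd W g * T}"

definition Rep :: "('a, 'b) monoid_scheme \<Rightarrow> ('a rep, complex mat) moncat" where
  "Rep G = \<lparr>Obj = reps G, Hom = intertwiners G, Comp = (*), Ident = (\<lambda>V. 1\<^sub>m (fst V)),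
     TenO = (\<lambda>V W. (fst V * fst W, \<lambda>g. kron (snd V g) (snd W g))), TenM = kron,
     Unit = (1, \<lambda>g. 1\<^sub>m 1),
     Assoc = (\<lambda>U V W. 1\<^sub>m (fst U * fst V * fst W)),
     LUnit = (\<lambda>V. 1\<^sub>m (fst V)), RUnit = (\<lambda>V. 1\<^sub>m (fst V))\<rparr>"


section \<open>Isocategorical groups\<close>

text \<open>
  An equivalence of tensor categories over the complex numbers is a monoidal equivalence that is
  complex linear on morphisms; compatibility with the symmetry is not required.
\<close>

definition isocategorical :: "('a, 'c) monoid_scheme \<Rightarrow> ('b, 'd) monoid_scheme \<Rightarrow> bool" where
  "isocategorical G H \<longleftrightarrow> (\<exists>F0 F1 J u. monoidal_equivalence (Rep G) (Rep H) F0 F1 J u \<and>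
     (\<forall>V \<in> Obj (Rep G). \<forall>W \<in> Obj (Rep G). \<forall>S \<in> Hom (Rep G) V W. \<forall>T \<in> Hom (Rep G) V W. \<forall>c.
        F1 V W (S + T) = F1 V W S + F1 V W T \<and> F1 V W (c \<cdot>\<^sub>m S) = c \<cdot>\<^sub>m F1 V W S))"

text \<open>
  Every finite group is isomorphic to one whose carrier is a set of natural numbers, so
  quantities are taken on groups of type \<open>nat monoid\<close>.
\<close>

definition monoidal_Morita_invariant :: "(nat monoid \<Rightarrow> 'v) \<Rightarrow> bool" where
  "monoidal_Morita_invariant q \<longleftrightarrow> (\<forall>G1 G2. group G1 \<and> finite (carrier G1) \<and>
     group G2 \<and> finite (carrier G2) \<and> isocategorical G1 G2 \<longrightarrow> q G1 = q G2)"

definition num_subgroups :: "('a, 'b) monoid_scheme \<Rightarrow> nat" where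
  "num_subgroups G = card {H. subgroup H G}"

definition num_subgroups_iso ::
  "('c, 'd) monoid_scheme \<Rightarrow> ('a, 'b) monoid_scheme \<Rightarrow> nat" where
  "num_subgroups_iso L G = card {H. subgroup H G \<and> G\<lparr>carrier := H\<rparr> \<cong> L}"


section \<open>Well-definedness of the tensor category\<close>

lemma dim_kron [simp]:
  "dim_row (kron A B) = dim_row A * dim_row B" "dim_col (kron A B) = dim_col A * dim_col B"
  by (simp_all add: kron_def)

lemma kron_carrier [simp, intro]:
  "\<lbrakk>A \<in> carrier_mat m n; B \<in> carrier_mat p q\<rbrakk> \<Longrightarrow> kron A B \<in> carrier_mat (m * p) (n * q)"
  by (auto simp: kron_def)

lemma div_lt_mult: "(i::nat) < m * n \<Longrightarrow> i div n < m"
  by (simp add: less_mult_imp_div_less)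

lemma mod_lt_mult: "(i::nat) < m * n \<Longrightarrow> i mod n < n"
  by (cases "n = 0") auto

lemma kron_assoc:
  "kron (kron A B) C = kron A (kron B (C :: 'a :: semigroup_mult mat))"
proof (rule eq_matI)
  fix i j
  assume "i < dim_row (kron A (kron B C))" "j < dim_col (kron A (kron B C))"
  then have i: "i < dim_row A * dim_row B * dim_row C" and j: "j < dim_col A * dim_col B * dim_col C"
    by (simp_all add: mult.assoc)
  then have i': "i < dim_row A * (dim_row B * dim_row C)" and j': "j < dim_col A * (dim_col B * dim_col C)"
    by (simp_all add: mult.assoc)
  have m1: "k mod (p * q) div q = k div q mod p" for k p q :: nat
    by (cases "q = 0") (simp_all add: mod_mult2_eq mult.commute[of p q])
  have m2: "k mod (p * q) mod q = k mod q" for k p q :: nat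
    by (simp add: mod_mod_cancel)
  have d: "k div (p * q) = k div q div p" for k p q :: nat
    by (metis div_mult2_eq mult.commute)
  show "kron (kron A B) C $$ (i, j) = kron A (kron B C) $$ (i, j)"
    using i j i' j' mod_lt_mult[OF i'] mod_lt_mult[OF j'] div_lt_mult[OF i] div_lt_mult[OF j]
    by (simp add: kron_def m1 m2 d mult.assoc)
qed (simp_all add: mult.assoc)

lemma kron_one: "kron (1\<^sub>m m) (1\<^sub>m n) = (1\<^sub>m (m * n) :: 'a :: semiring_1 mat)"
proof (rule eq_matI)
  fix i j
  assume "i < dim_row (1\<^sub>m (m * n) :: 'a mat)" "j < dim_col (1\<^sub>m (m * n) :: 'a mat)"
  then have i: "i < m * n" and j: "j < m * n" by simp_all
  have "i = j" if "i div n = j div n" "i mod n = j mod n"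
    using that by (metis div_mult_mod_eq)
  then show "kron (1\<^sub>m m) (1\<^sub>m n) $$ (i, j) = (1\<^sub>m (m * n) :: 'a mat) $$ (i, j)"
    using i j div_lt_mult[OF i] div_lt_mult[OF j] mod_lt_mult[OF i] mod_lt_mult[OF j]
    by (auto simp: kron_def)
qed simp_all

lemma kron_one_left: "kron (1\<^sub>m 1) A = (A :: 'a :: semiring_1 mat)"
  by (rule eq_matI) (auto simp: kron_def)

lemma kron_one_right: "kron A (1\<^sub>m 1) = (A :: 'a :: semiring_1 mat)"
  by (rule eq_matI) (auto simp: kron_def)

lemma sum_div_mod:
  fixes f :: "nat \<Rightarrow> nat \<Rightarrow> 'a :: comm_monoid_add"
  shows "(\<Sum>k = 0..<m * n. f (k div n) (k mod n)) = (\<Sum>i = 0..<m. \<Sum>j = 0..<n. f i j)"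
proof -
  have "(\<Sum>i = 0..<m. \<Sum>j = 0..<n. f i j) = (\<Sum>(i, j) \<in> {0..<m} \<times> {0..<n}. f i j)"
    by (simp add: sum.cartesian_product)
  also have "\<dots> = (\<Sum>k = 0..<m * n. f (k div n) (k mod n))"
  proof (rule sum.reindex_bij_witness[where j = "\<lambda>(i, j). i * n + j" and i = "\<lambda>k. (k div n, k mod n)"])
    fix p assume "p \<in> {0..<m} \<times> {0..<n}"
    then obtain i j where p: "p = (i, j)" "i < m" "j < n" by auto
    have "i * n + j < Suc i * n" using p by simp
    also have "\<dots> \<le> m * n" using p by (intro mult_right_mono) auto
    finally show "(case p of (i, j) \<Rightarrow> i * n + j) \<in> {0..<m * n}" using p by simp
  qed (auto simp: div_lt_mult mod_lt_mult)
  finally show ?thesis by simp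
qed

lemma kron_mult:
  fixes A B A' B' :: "'a :: comm_semiring_1 mat"
  assumes A: "A \<in> carrier_mat m n" and B: "B \<in> carrier_mat n p"
    and A': "A' \<in> carrier_mat m' n'" and B': "B' \<in> carrier_mat n' p'"
  shows "kron (A * B) (A' * B') = kron A A' * kron B B'"
proof (rule eq_matI)
  fix i j
  assume "i < dim_row (kron A A' * kron B B')" "j < dim_col (kron A A' * kron B B')"
  then have i: "i < m * m'" and j: "j < p * p'" using assms by auto
  note b = div_lt_mult[OF i] div_lt_mult[OF j] mod_lt_mult[OF i] mod_lt_mult[OF j]
  have "kron (A * B) (A' * B') $$ (i, j) =
      (\<Sum>k = 0..<n. A $$ (i div m', k) * B $$ (k, j div p')) *
      (\<Sum>l = 0..<n'. A' $$ (i mod m', l) * B' $$ (l, j mod p'))"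
    using assms i j b by (auto simp: kron_def scalar_prod_def)
  also have "\<dots> = (\<Sum>k = 0..<n. \<Sum>l = 0..<n'.
      (A $$ (i div m', k) * A' $$ (i mod m', l)) * (B $$ (k, j div p') * B' $$ (l, j mod p')))"
    by (simp add: sum_product mult_ac)
  also have "\<dots> = (\<Sum>k = 0..<n * n'.
      (A $$ (i div m', k div n') * A' $$ (i mod m', k mod n')) *
      (B $$ (k div n', j div p') * B' $$ (k mod n', j mod p')))"
    by (simp add: sum_div_mod[where f = "\<lambda>k l. (A $$ (i div m', k) * A' $$ (i mod m', l)) *
      (B $$ (k, j div p') * B' $$ (l, j mod p'))"])
  also have "\<dots> = (kron A A' * kron B B') $$ (i, j)"
    using assms i j b by (auto simp: kron_def scalar_prod_def)
  finally show "kron (A * B) (A' * B') $$ (i, j) = (kron A A' * kron B B') $$ (i, j)" .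
qed (use assms in auto)

lemma Rep_simps:
  "Obj (Rep G) = reps G" "Hom (Rep G) = intertwiners G" "Comp (Rep G) = (*)"
  "Ident (Rep G) V = 1\<^sub>m (fst V)"
  "TenO (Rep G) V W = (fst V * fst W, \<lambda>g. kron (snd V g) (snd W g))"
  "TenM (Rep G) = kron" "Unit (Rep G) = (1, \<lambda>g. 1\<^sub>m 1)"
  "Assoc (Rep G) U V W = 1\<^sub>m (fst U * fst V * fst W)"
  "LUnit (Rep G) V = 1\<^sub>m (fst V)" "RUnit (Rep G) V = 1\<^sub>m (fst V)"
  by (simp_all add: Rep_def)

lemma reps_carrier: "V \<in> reps G \<Longrightarrow> g \<in> carrier G \<Longrightarrow> snd V g \<in> carrier_mat (fst V) (fst V)"
  by (auto simp: reps_def)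

lemma intertwiners_carrier: "T \<in> intertwiners G V W \<Longrightarrow> T \<in> carrier_mat (fst W) (fst V)"
  by (auto simp: intertwiners_def)

lemma one_intertwiner:
  assumes "\<And>g. g \<in> carrier G \<Longrightarrow> snd V g \<in> carrier_mat n n"
    and "\<And>g. g \<in> carrier G \<Longrightarrow> snd W g = snd V g" and "fst V = n" "fst W = n"
  shows "1\<^sub>m n \<in> intertwiners G V W"
proof -
  have "1\<^sub>m n * snd V g = snd W g * 1\<^sub>m n" if "g \<in> carrier G" for g
    using assms(1,2)[OF that] by (simp only: left_mult_one_mat right_mult_one_mat)
  then show ?thesis using assms(3,4) by (simp add: intertwiners_def)
qed

lemma cat_iso_Rep_one:
  assumes "\<And>g. g \<in> carrier G \<Longrightarrow> snd V g \<in> carrier_mat n n"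
    and "\<And>g. g \<in> carrier G \<Longrightarrow> snd W g = snd V g" and "fst V = n" "fst W = n"
  shows "cat_iso (Rep G) V W (1\<^sub>m n)"
proof -
  have "1\<^sub>m n \<in> intertwiners G V W" "1\<^sub>m n \<in> intertwiners G W V"
    using assms by (auto intro: one_intertwiner)
  then show ?thesis
    unfolding cat_iso_def Rep_simps using assms(3,4) by (auto intro!: bexI[of _ "1\<^sub>m n"])
qed

lemma category_Rep: "category (Rep G)"
proof
  fix V assume "V \<in> Obj (Rep G)"
  then show "Ident (Rep G) V \<in> Hom (Rep G) V V"
    unfolding Rep_simps by (intro one_intertwiner) (simp_all add: reps_carrier)
next
  fix U V W S T
  assume a: "U \<in> Obj (Rep G)" "V \<in> Obj (Rep G)" "W \<in> Obj (Rep G)"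
    "S \<in> Hom (Rep G) U V" "T \<in> Hom (Rep G) V W"
  have S: "S \<in> carrier_mat (fst V) (fst U)" and T: "T \<in> carrier_mat (fst W) (fst V)"
    using a by (simp_all add: Rep_simps intertwiners_carrier)
  have "T * S * snd U g = snd W g * (T * S)" if g: "g \<in> carrier G" for g
  proof -
    have r: "snd U g \<in> carrier_mat (fst U) (fst U)" "snd V g \<in> carrier_mat (fst V) (fst V)"
      "snd W g \<in> carrier_mat (fst W) (fst W)"
      using a g by (simp_all add: Rep_simps reps_carrier)
    have "T * S * snd U g = T * (S * snd U g)" using S T r by simp
    also have "S * snd U g = snd V g * S" using a g by (simp add: Rep_simps intertwiners_def)
    also have "T * (snd V g * S) = T * snd V g * S" using S T r by simp
    also have "T * snd V g = snd W g * T" using a g by (simp add: Rep_simps intertwiners_def)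
    finally show ?thesis using S T r by simp
  qed
  then show "T \<star>\<^bsub>Rep G\<^esub> S \<in> Hom (Rep G) U W"
    using S T by (auto simp: Rep_simps intertwiners_def)
next
  fix V W T assume "T \<in> Hom (Rep G) V W"
  then have T: "T \<in> carrier_mat (fst W) (fst V)"
    by (simp add: Rep_simps intertwiners_carrier)
  show "T \<star>\<^bsub>Rep G\<^esub> Ident (Rep G) V = T" "Ident (Rep G) W \<star>\<^bsub>Rep G\<^esub> T = T"
    using T by (simp_all add: Rep_simps)
next
  fix U V W X R S T
  assume "R \<in> Hom (Rep G) U V" "S \<in> Hom (Rep G) V W" "T \<in> Hom (Rep G) W X"
  then show "T \<star>\<^bsub>Rep G\<^esub> S \<star>\<^bsub>Rep G\<^esub> R = T \<star>\<^bsub>Rep G\<^esub> (S \<star>\<^bsub>Rep G\<^esub> R)"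
    unfolding Rep_simps by (meson assoc_mult_mat intertwiners_carrier)
qed

lemma monoidal_category_Rep:
  assumes "monoid G"
  shows "monoidal_category (Rep G)"
proof -
  interpret category "Rep G" by (rule category_Rep)
  interpret monoid G by fact
  have ten: "(fst V * fst W, \<lambda>g. kron (snd V g) (snd W g)) \<in> reps G"
    if V: "V \<in> reps G" and W: "W \<in> reps G" for V W
  proof -
    have "kron (snd V (g \<otimes>\<^bsub>G\<^esub> h)) (snd W (g \<otimes>\<^bsub>G\<^esub> h))
        = kron (snd V g) (snd W g) * kron (snd V h) (snd W h)"
      if gh: "g \<in> carrier G" "h \<in> carrier G" for g h
    proof -
      have "snd V (g \<otimes>\<^bsub>G\<^esub> h) = snd V g * snd V h" "snd W (g \<otimes>\<^bsub>G\<^esub> h) = snd W g * snd W h"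
        using V W gh by (auto simp: reps_def)
      then show ?thesis
        using kron_mult[OF reps_carrier[OF V gh(1)] reps_carrier[OF V gh(2)]
          reps_carrier[OF W gh(1)] reps_carrier[OF W gh(2)]] by simp
    qed
    moreover have "kron (snd V \<one>\<^bsub>G\<^esub>) (snd W \<one>\<^bsub>G\<^esub>) = 1\<^sub>m (fst V * fst W)"
      using V W by (auto simp: reps_def kron_one)
    ultimately show ?thesis
      using reps_carrier[OF V] reps_carrier[OF W] by (simp add: reps_def)
  qed
  have tenh: "kron S T \<in> intertwiners G (fst V * fst V', \<lambda>g. kron (snd V g) (snd V' g))
        (fst W * fst W', \<lambda>g. kron (snd W g) (snd W' g))"
    if a: "V \<in> reps G" "W \<in> reps G" "V' \<in> reps G" "W' \<in> reps G"
      "S \<in> intertwiners G V W" "T \<in> intertwiners G V' W'" for V W V' W' S T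
  proof -
    note c = a(5,6)[THEN intertwiners_carrier]
    have "kron S T * kron (snd V g) (snd V' g) = kron (snd W g) (snd W' g) * kron S T"
      if g: "g \<in> carrier G" for g
    proof -
      note r = a(1-4)[THEN reps_carrier, OF g]
      have "kron S T * kron (snd V g) (snd V' g) = kron (S * snd V g) (T * snd V' g)"
        by (rule kron_mult[symmetric, OF c(1) r(1) c(2) r(3)])
      also have "\<dots> = kron (snd W g * S) (snd W' g * T)"
        using a g by (simp add: intertwiners_def)
      also have "\<dots> = kron (snd W g) (snd W' g) * kron S T"
        by (rule kron_mult[OF r(2) c(1) r(4) c(2)])
      finally show ?thesis .
    qed
    then show ?thesis using c by (simp add: intertwiners_def)
  qed
  show ?thesis
  proof
    fix U V W U' V' W' f g f' g'
    assume "U \<in> Obj (Rep G)" "V \<in> Obj (Rep G)" "W \<in> Obj (Rep G)"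
      "U' \<in> Obj (Rep G)" "V' \<in> Obj (Rep G)" "W' \<in> Obj (Rep G)"
      "f \<in> Hom (Rep G) U V" "g \<in> Hom (Rep G) V W" "f' \<in> Hom (Rep G) U' V'" "g' \<in> Hom (Rep G) V' W'"
    then show "(g \<star>\<^bsub>Rep G\<^esub> f) \<boxdot>\<^bsub>Rep G\<^esub> (g' \<star>\<^bsub>Rep G\<^esub> f')
        = (g \<boxdot>\<^bsub>Rep G\<^esub> g') \<star>\<^bsub>Rep G\<^esub> (f \<boxdot>\<^bsub>Rep G\<^esub> f')"
      by (auto simp: Rep_simps intro!: kron_mult dest!: intertwiners_carrier)
  next
    fix U V W U' V' W' f g h
    assume "f \<in> Hom (Rep G) U U'" "g \<in> Hom (Rep G) V V'" "h \<in> Hom (Rep G) W W'"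
    then have k: "kron f (kron g h) \<in> carrier_mat (fst U' * fst V' * fst W') (fst U * fst V * fst W)"
      by (auto simp: Rep_simps mult.assoc dest!: intertwiners_carrier)
    show "Assoc (Rep G) U' V' W' \<star>\<^bsub>Rep G\<^esub> ((f \<boxdot>\<^bsub>Rep G\<^esub> g) \<boxdot>\<^bsub>Rep G\<^esub> h)
        = (f \<boxdot>\<^bsub>Rep G\<^esub> (g \<boxdot>\<^bsub>Rep G\<^esub> h)) \<star>\<^bsub>Rep G\<^esub> Assoc (Rep G) U V W"
      unfolding Rep_simps kron_assoc left_mult_one_mat[OF k] right_mult_one_mat[OF k] by (rule refl)
  next
    fix U V W assume "U \<in> Obj (Rep G)" "V \<in> Obj (Rep G)" "W \<in> Obj (Rep G)"
    then have k: "kron (kron (snd U g) (snd V g)) (snd W g)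
        \<in> carrier_mat (fst U * fst V * fst W) (fst U * fst V * fst W)" if "g \<in> carrier G" for g
      using that by (simp add: Rep_simps kron_carrier reps_carrier)
    show "cat_iso (Rep G) ((U \<boxtimes>\<^bsub>Rep G\<^esub> V) \<boxtimes>\<^bsub>Rep G\<^esub> W) (U \<boxtimes>\<^bsub>Rep G\<^esub> (V \<boxtimes>\<^bsub>Rep G\<^esub> W)) (Assoc (Rep G) U V W)"
      unfolding Rep_simps
      by (rule cat_iso_Rep_one; simp only: fst_conv snd_conv k kron_assoc[symmetric] mult.assoc[symmetric])
  next
    fix V W f assume "V \<in> Obj (Rep G)" "W \<in> Obj (Rep G)" "f \<in> Hom (Rep G) V W"
    then have f: "f \<in> carrier_mat (fst W) (fst V)"
      by (simp add: Rep_simps intertwiners_carrier)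
    show "LUnit (Rep G) W \<star>\<^bsub>Rep G\<^esub> (Ident (Rep G) (Unit (Rep G)) \<boxdot>\<^bsub>Rep G\<^esub> f) = f \<star>\<^bsub>Rep G\<^esub> LUnit (Rep G) V"
      and "RUnit (Rep G) W \<star>\<^bsub>Rep G\<^esub> (f \<boxdot>\<^bsub>Rep G\<^esub> Ident (Rep G) (Unit (Rep G))) = f \<star>\<^bsub>Rep G\<^esub> RUnit (Rep G) V"
      unfolding Rep_simps fst_conv kron_one_left kron_one_right
        left_mult_one_mat[OF f] right_mult_one_mat[OF f] by (rule refl)+
  next
    fix V assume "V \<in> Obj (Rep G)"
    then have V: "snd V g \<in> carrier_mat (fst V) (fst V)" if "g \<in> carrier G" for g
      using that by (simp add: Rep_simps reps_carrier)
    show "cat_iso (Rep G) (Unit (Rep G) \<boxtimes>\<^bsub>Rep G\<^esub> V) V (LUnit (Rep G) V)"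
      and "cat_iso (Rep G) (V \<boxtimes>\<^bsub>Rep G\<^esub> Unit (Rep G)) V (RUnit (Rep G) V)"
      unfolding Rep_simps fst_conv snd_conv kron_one_left kron_one_right
      by (rule cat_iso_Rep_one; simp add: V)+
  next
    show "Unit (Rep G) \<in> Obj (Rep G)" by (simp add: Rep_simps reps_def)
  next
    fix U V U' V' f g
    assume "U \<in> Obj (Rep G)" "V \<in> Obj (Rep G)" "U' \<in> Obj (Rep G)" "V' \<in> Obj (Rep G)"
      "f \<in> Hom (Rep G) U V" "g \<in> Hom (Rep G) U' V'"
    then show "f \<boxdot>\<^bsub>Rep G\<^esub> g \<in> Hom (Rep G) (U \<boxtimes>\<^bsub>Rep G\<^esub> U') (V \<boxtimes>\<^bsub>Rep G\<^esub> V')"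
      unfolding Rep_simps by (rule tenh)
  next
    fix V W assume "V \<in> Obj (Rep G)" "W \<in> Obj (Rep G)"
    then show "V \<boxtimes>\<^bsub>Rep G\<^esub> W \<in> Obj (Rep G)"
      unfolding Rep_simps by (rule ten)
  qed (simp_all add: Rep_simps kron_one mult.assoc)
qed

end

theory Submission
  imports Defs "HOL-Library.Cardinality" "HOL-Library.Z2" "HOL-Library.Product_Plus"
    "HOL-Library.Countable"
begin

text \<open>
  Let \<open>K = F\<^sub>2\<^sup>2\<close> act on \<open>A = F\<^sub>2\<^sup>2 \<times> F\<^sub>2\<^sup>2\<close> by the shears \<open>(a, b) \<mapsto> (a, b + M\<^sub>k a)\<close>, where \<open>M\<^sub>k\<close> is the symmetric matrix with
  rows \<open>(0, k2)\<close> and \<open>(k2, k1)\<close>.  The two groups, both of order 64, are the semidirect product of \<open>A\<close> and \<open>K\<close>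
  and the extension of \<open>K\<close> by \<open>A\<close> with the same action and the cocycle \<open>(k, l) \<mapsto> (0, (0, k1 l1))\<close>, which does
  not split (\<open>nonsplit_shear\<close>).

  They are isocategorical for the following reason.  The subgroup of all \<open>(0, b)\<close> is central in both, so a
  representation of either decomposes according to the characters \<open>x\<close> of this subgroup.  Multiply the action of
  an element over \<open>k\<close> by \<open>\<theta>\<^sub>k(x)\<close> on the component of \<open>x\<close>, where \<open>\<theta>\<^sub>k\<close> is \<open>\<i>\<close> to the power of the quadratic form of
  \<open>M\<^sub>k\<close>.  The function \<open>\<theta>\<close> fails to be multiplicative in \<open>k\<close> precisely by the value of \<open>x\<close> on the cocycle, so this
  turns representations of the first group into representations of the second, with the same intertwiners.
  It also fails to be a character in \<open>x\<close>, and \<open>\<theta>\<^sub>k(x + y) / (\<theta>\<^sub>k(x) \<theta>\<^sub>k(y))\<close> is the sign of \<open>x \<bullet> M\<^sub>k y\<close>.  But \<open>M\<^sub>k y\<close> is the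
  commutator of \<open>k\<close> with the element \<open>(y, 0)\<close> of \<open>A\<close>.  Hence the operator that applies \<open>(y, 0)\<close> to the
  first tensor factor when the second one lies in the component of \<open>y\<close> carries the tensor product of the twisted
  representations to the twisted tensor product.  It is coherent because \<open>y \<mapsto> (y, 0)\<close> is a homomorphism.
  The general form of this argument is \<open>twist_isocategorical\<close>.

  The numbers of subgroups are compared in bulk, without computing either.  A subgroup of an extension of \<open>K\<close> by \<open>A\<close> has an
  intersection \<open>U\<close> with \<open>A\<close> and an image \<open>K'\<close> in \<open>K\<close>.  The subgroups with given \<open>U\<close> and \<open>K'\<close> are either absent or
  in bijection with the one-cocycles of \<open>K'\<close> with values in \<open>A / U\<close>.  In the semidirect product
  they are never absent when \<open>U\<close> is stable under \<open>K'\<close>, whereas in a non-split extension they are absent for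
  \<open>U = 0\<close> and \<open>K' = K\<close>.  So the semidirect product has strictly more subgroups (\<open>nonsplit_num_subgroups_less\<close>).

  This settles the total number.  It also shows that the two groups are not isomorphic, so for the second
  claim the semidirect product itself serves as \<open>L\<close>: as the orders agree, only one of the two groups has a
  subgroup isomorphic to it (\<open>num_subgroups_iso_differ\<close>).
\<close>

section \<open>Sums of matrices and resolutions of the identity\<close>

text \<open>
  Matrices of different sizes share one type, so they form no additive monoid with a
  zero; the size of the sum is therefore a parameter.
\<close>
definition msum :: "nat \<Rightarrow> nat \<Rightarrow> ('x::finite \<Rightarrow> complex mat) \<Rightarrow> complex mat" where
  "msum m n f = mat m n (\<lambda>ij. \<Sum>x\<in>UNIV. f x $$ ij)"

lemma msum_carrier [simp, intro]: "msum m n f \<in> carrier_mat m n"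
  by (simp add: msum_def)

lemma msum_dim [simp]: "dim_row (msum m n f) = m" "dim_col (msum m n f) = n"
  by (simp_all add: msum_def)

lemma msum_index [simp]:
  "i < m \<Longrightarrow> j < n \<Longrightarrow> msum m n f $$ (i, j) = (\<Sum>x\<in>UNIV. f x $$ (i, j))"
  by (simp add: msum_def)

lemma msum_mult:
  assumes "\<And>x. f x \<in> carrier_mat m n" and B: "B \<in> carrier_mat n p"
  shows "msum m n f * B = msum m p (\<lambda>x. f x * B)"
proof (rule eq_matI)
  fix i j assume ij: "i < dim_row (msum m p (\<lambda>x. f x * B))" "j < dim_col (msum m p (\<lambda>x. f x * B))"
  have d: "dim_row (f x) = m" "dim_col (f x) = n" for x using assms(1)[of x] by auto
  show "(msum m n f * B) $$ (i, j) = msum m p (\<lambda>x. f x * B) $$ (i, j)"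
    using ij B d by (simp add: scalar_prod_def sum_distrib_right, subst sum.swap, simp)
qed (use B in auto)

lemma mult_msum:
  assumes "\<And>x. f x \<in> carrier_mat m n" and B: "B \<in> carrier_mat p m"
  shows "B * msum m n f = msum p n (\<lambda>x. B * f x)"
proof (rule eq_matI)
  fix i j assume ij: "i < dim_row (msum p n (\<lambda>x. B * f x))" "j < dim_col (msum p n (\<lambda>x. B * f x))"
  have d: "dim_row (f x) = m" "dim_col (f x) = n" for x using assms(1)[of x] by auto
  show "(B * msum m n f) $$ (i, j) = msum p n (\<lambda>x. B * f x) $$ (i, j)"
    using ij B d by (simp add: scalar_prod_def sum_distrib_left, subst sum.swap, simp)
qed (use B in auto)

lemma msum_smult_const:
  assumes "A \<in> carrier_mat m n"
  shows "msum m n (\<lambda>x. c x \<cdot>\<^sub>m A) = (\<Sum>x\<in>UNIV. c x) \<cdot>\<^sub>m A"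
  using assms by (intro eq_matI) (auto simp: sum_distrib_right)

lemma msum_delta:
  assumes "\<And>x. A x \<in> carrier_mat m n"
  shows "msum m n (\<lambda>x. (if x = w then 1 else 0) \<cdot>\<^sub>m A x) = A w"
proof (rule eq_matI)
  have d: "dim_row (A x) = m" "dim_col (A x) = n" for x using assms(1)[of x] by auto
  fix i j assume "i < dim_row (A w)" "j < dim_col (A w)"
  then show "msum m n (\<lambda>x. (if x = w then 1 else 0) \<cdot>\<^sub>m A x) $$ (i, j) = A w $$ (i, j)"
    using d by (simp add: if_distrib[where f = "\<lambda>c. c * _"] sum.delta cong: if_cong)
qed (use assms[of w] in auto)

lemma smult_kron:
  fixes A B :: "'a :: comm_semiring_1 mat"
  shows "kron (c \<cdot>\<^sub>m A) (d \<cdot>\<^sub>m B) = (c * d) \<cdot>\<^sub>m kron A B"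
  by (rule eq_matI) (auto simp: kron_def div_lt_mult mod_lt_mult mult_ac)

lemma smult_one [simp]: "(1 :: 'a :: semiring_1) \<cdot>\<^sub>m A = A"
  by (rule eq_matI) auto

lemma smult_smult: "a \<cdot>\<^sub>m (b \<cdot>\<^sub>m A) = (a * b :: 'a :: semigroup_mult) \<cdot>\<^sub>m A"
  by (rule eq_matI) (auto simp: mult.assoc)

text \<open>
  Only completeness of the family is recorded, because completeness alone lets an identity of
  matrices be tested on the members.  Orthogonality of the weight projections enters through
  \<open>weight_proj_mult\<close> below.
\<close>
definition resolution :: "nat \<Rightarrow> ('x::finite \<Rightarrow> complex mat) \<Rightarrow> bool" where
  "resolution n P \<longleftrightarrow> (\<forall>x. P x \<in> carrier_mat n n) \<and> msum n n P = 1\<^sub>m n"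

text \<open>
  The later operators are sums over characters.  This rule reduces an equation between them to single
  weight components, where each of them is a scalar or one summand.
\<close>
lemma resolution_eqI:
  assumes P: "resolution n P" and M: "M \<in> carrier_mat m n" and N: "N \<in> carrier_mat m n"
    and eq: "\<And>x. M * P x = N * P x"
  shows "M = N"
proof -
  have "M = M * msum n n P" using P M by (simp add: resolution_def)
  also have "\<dots> = msum m n (\<lambda>x. M * P x)" using P M by (intro mult_msum) (auto simp: resolution_def)
  also have "\<dots> = msum m n (\<lambda>x. N * P x)" using eq by simp
  also have "\<dots> = N * msum n n P"
    using P N by (intro mult_msum[symmetric]) (auto simp: resolution_def)
  also have "\<dots> = N" using P N by (simp add: resolution_def)
  finally show ?thesis .
qed

lemma resolution_kron:
  fixes P :: "'x::finite \<Rightarrow> complex mat" and R :: "'y::finite \<Rightarrow> complex mat"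
  assumes P: "resolution m P" and R: "resolution n R"
  shows "resolution (m * n) (\<lambda>(x, y). kron (P x) (R y))"
proof -
  have c: "P x \<in> carrier_mat m m" "R y \<in> carrier_mat n n" for x y
    using P R by (auto simp: resolution_def)
  have d: "dim_row (P x) = m" "dim_col (P x) = m" "dim_row (R y) = n" "dim_col (R y) = n" for x y
    using c(1)[of x] c(2)[of y] by auto
  have "msum (m * n) (m * n) (\<lambda>(x, y). kron (P x) (R y)) = kron (msum m m P) (msum n n R)"
  proof (rule eq_matI)
    fix i j assume "i < dim_row (kron (msum m m P) (msum n n R))"
      "j < dim_col (kron (msum m m P) (msum n n R))"
    then have i: "i < m * n" and j: "j < m * n" by simp_all
    have "msum (m * n) (m * n) (\<lambda>(x, y). kron (P x) (R y)) $$ (i, j) =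
      (\<Sum>(x, y)\<in>UNIV \<times> UNIV. P x $$ (i div n, j div n) * R y $$ (i mod n, j mod n))"
      using i j d by (simp add: kron_def case_prod_unfold)
    also have "\<dots> = (\<Sum>x\<in>UNIV. P x $$ (i div n, j div n)) * (\<Sum>y\<in>UNIV. R y $$ (i mod n, j mod n))"
      by (simp only: sum_product sum.cartesian_product)
    also have "\<dots> = kron (msum m m P) (msum n n R) $$ (i, j)"
      using i j by (simp add: kron_def div_lt_mult mod_lt_mult)
    finally show "msum (m * n) (m * n) (\<lambda>(x, y). kron (P x) (R y)) $$ (i, j)
      = kron (msum m m P) (msum n n R) $$ (i, j)" .
  qed simp_all
  then show ?thesis using P R c by (auto simp: resolution_def kron_one)
qed

section \<open>Weights of a central subgroup\<close>

text \<open>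
  The columns of \<open>T\<close> are joint eigenvectors of the operators \<open>\<iota> c\<close>, with eigenvalues \<open>\<chi> w c\<close>.  Matrices
  rather than vectors are used so that weights can be tensored with \<open>kron\<close>.
\<close>
definition weight :: "('c \<Rightarrow> 'a) \<Rightarrow> ('x \<Rightarrow> 'c \<Rightarrow> complex) \<Rightarrow> 'a rep \<Rightarrow> 'x \<Rightarrow> complex mat \<Rightarrow> bool" where
  "weight \<iota> \<chi> V w T \<longleftrightarrow> dim_row T = fst V \<and> (\<forall>c. snd V (\<iota> c) * T = \<chi> w c \<cdot>\<^sub>m T)"

text \<open>
  The usual idempotent of the group algebra that belongs to the character \<open>\<chi> x\<close>.
\<close>
definition weight_proj :: "('c::{finite,ab_group_add} \<Rightarrow> 'a) \<Rightarrow> ('x \<Rightarrow> 'c \<Rightarrow> complex) \<Rightarrow> 'a rep \<Rightarrow> 'x \<Rightarrow> complex mat" where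
  "weight_proj \<iota> \<chi> V x =
     msum (fst V) (fst V) (\<lambda>c. (\<chi> x (- c) / of_nat CARD('c)) \<cdot>\<^sub>m snd V (\<iota> c))"

text \<open>
  The element of the group algebra of the central subgroup whose Fourier transform is \<open>f\<close>.
\<close>
definition diag_op :: "('c::{finite,ab_group_add} \<Rightarrow> 'a) \<Rightarrow> ('x::finite \<Rightarrow> 'c \<Rightarrow> complex)
    \<Rightarrow> 'a rep \<Rightarrow> ('x \<Rightarrow> complex) \<Rightarrow> complex mat" where
  "diag_op \<iota> \<chi> V f = msum (fst V) (fst V) (\<lambda>x. f x \<cdot>\<^sub>m weight_proj \<iota> \<chi> V x)"

definition tensor_rep :: "'a rep \<Rightarrow> 'a rep \<Rightarrow> 'a rep" where
  "tensor_rep V W = (fst V * fst W, \<lambda>g. kron (snd V g) (snd W g))"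

lemma reps_mult:
  assumes "V \<in> reps K" "g \<in> carrier K" "h \<in> carrier K"
  shows "snd V (g \<otimes>\<^bsub>K\<^esub> h) = snd V g * snd V h"
  using assms by (auto simp: reps_def)

lemma reps_one: "V \<in> reps K \<Longrightarrow> snd V \<one>\<^bsub>K\<^esub> = 1\<^sub>m (fst V)"
  by (auto simp: reps_def)

lemma fst_tensor_rep [simp]: "fst (tensor_rep V W) = fst V * fst W"
  by (simp add: tensor_rep_def)

lemma tensor_rep_reps:
  assumes "monoid G" "V \<in> reps G" "W \<in> reps G"
  shows "tensor_rep V W \<in> reps G"
  using monoidal_category.ten_obj[OF monoidal_category_Rep[OF assms(1)], of V W] assms
  by (simp add: Rep_simps tensor_rep_def)

lemma TenO_Rep: "TenO (Rep G) V W = tensor_rep V W"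
  by (simp add: Rep_simps tensor_rep_def)

lemma weight_proj_carrier [simp, intro]: "weight_proj \<iota> \<chi> V x \<in> carrier_mat (fst V) (fst V)"
  by (simp add: weight_proj_def)

lemma diag_op_carrier [simp, intro]: "diag_op \<iota> \<chi> V f \<in> carrier_mat (fst V) (fst V)"
  by (simp add: diag_op_def)

text \<open>
  The type \<open>'c\<close> is a finite abelian group embedded centrally in \<open>G\<close>, and \<open>'x\<close> is its group of characters,
  presented through the pairing \<open>\<chi>\<close>; the two sum conditions are the orthogonality relations.
\<close>
locale central_weights = group G for G :: "('a, 'm) monoid_scheme" (structure) +
  fixes \<iota> :: "'c::{finite,ab_group_add} \<Rightarrow> 'a"
    and \<chi> :: "'x::{finite,ab_group_add} \<Rightarrow> 'c \<Rightarrow> complex"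
  assumes \<iota>_closed [simp]: "\<iota> c \<in> carrier G"
    and \<iota>_add: "\<iota> (c + d) = \<iota> c \<otimes> \<iota> d"
    and \<iota>_central: "g \<in> carrier G \<Longrightarrow> \<iota> c \<otimes> g = g \<otimes> \<iota> c"
    and \<chi>_zero_left [simp]: "\<chi> 0 c = 1"
    and \<chi>_zero_right [simp]: "\<chi> x 0 = 1"
    and \<chi>_add_left: "\<chi> (x + y) c = \<chi> x c * \<chi> y c"
    and \<chi>_add_right: "\<chi> x (c + d) = \<chi> x c * \<chi> x d"
    and \<chi>_sum_left: "x \<noteq> 0 \<Longrightarrow> (\<Sum>c\<in>UNIV. \<chi> x c) = 0"
    and \<chi>_sum_right: "c \<noteq> 0 \<Longrightarrow> (\<Sum>x\<in>UNIV. \<chi> x c) = 0"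
    and card_dual: "CARD('x) = CARD('c)"
begin

lemma \<iota>_zero [simp]: "\<iota> 0 = \<one>"
  using \<iota>_add[of 0 0] by (simp add: l_cancel_one)

lemma \<chi>_minus: "\<chi> x (- c) * \<chi> x c = 1"
  using \<chi>_add_right[of x "- c" c] by simp

lemma rep_\<iota>: "V \<in> reps G \<Longrightarrow> snd V (\<iota> c) \<in> carrier_mat (fst V) (fst V)"
  by (simp add: reps_carrier)

text \<open>
  Fourier inversion at the identity of the central subgroup.
\<close>
lemma weight_proj_resolution:
  assumes V: "V \<in> reps G"
  shows "resolution (fst V) (weight_proj \<iota> \<chi> V)"
proof -
  let ?n = "fst V" and ?N = "of_nat CARD('c) :: complex"
  have d: "dim_row (snd V (\<iota> c)) = ?n" "dim_col (snd V (\<iota> c)) = ?n" for c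
    using rep_\<iota>[OF V, of c] by auto
  have one: "snd V \<one> = 1\<^sub>m ?n" using V by (auto simp: reps_def)
  have sum: "(\<Sum>x\<in>UNIV. \<chi> x (- c)) = (if c = 0 then ?N else 0)" for c
    using \<chi>_sum_right[of "- c"] by (simp add: card_dual)
  have "msum ?n ?n (weight_proj \<iota> \<chi> V) = 1\<^sub>m ?n"
  proof (rule eq_matI)
    fix i j assume "i < dim_row (1\<^sub>m ?n :: complex mat)" "j < dim_col (1\<^sub>m ?n :: complex mat)"
    then have ij: "i < ?n" "j < ?n" by simp_all
    have "msum ?n ?n (weight_proj \<iota> \<chi> V) $$ (i, j) =
        (\<Sum>x\<in>UNIV. \<Sum>c\<in>UNIV. \<chi> x (- c) / ?N * snd V (\<iota> c) $$ (i, j))"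
      using ij d by (simp add: weight_proj_def)
    also have "\<dots> = (\<Sum>c\<in>UNIV. (\<Sum>x\<in>UNIV. \<chi> x (- c)) / ?N * snd V (\<iota> c) $$ (i, j))"
      by (subst sum.swap) (simp add: sum_distrib_right sum_divide_distrib)
    also have "\<dots> = (\<Sum>c\<in>UNIV. if c = 0 then snd V (\<iota> c) $$ (i, j) else 0)"
      by (intro sum.cong) (auto simp: sum)
    also have "\<dots> = 1\<^sub>m ?n $$ (i, j)" by (simp add: one)
    finally show "msum ?n ?n (weight_proj \<iota> \<chi> V) $$ (i, j) = 1\<^sub>m ?n $$ (i, j)" .
  qed simp_all
  then show ?thesis by (simp add: resolution_def)
qed

lemma weight_weight_proj:
  assumes V: "V \<in> reps G"
  shows "weight \<iota> \<chi> V w (weight_proj \<iota> \<chi> V w)"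
proof -
  let ?n = "fst V" and ?N = "of_nat CARD('c) :: complex"
  have "snd V (\<iota> c) * weight_proj \<iota> \<chi> V w = \<chi> w c \<cdot>\<^sub>m weight_proj \<iota> \<chi> V w" for c
  proof -
    have m: "snd V (\<iota> c) * ((\<chi> w (- d) / ?N) \<cdot>\<^sub>m snd V (\<iota> d)) =
        \<chi> w c \<cdot>\<^sub>m ((\<chi> w (- (c + d)) / ?N) \<cdot>\<^sub>m snd V (\<iota> (c + d)))" for d
    proof -
      have "snd V (\<iota> c) * snd V (\<iota> d) = snd V (\<iota> (c + d))"
        using V by (auto simp: reps_def \<iota>_add)
      moreover have "\<chi> w c * \<chi> w (- (c + d)) = \<chi> w (- d)"
        using \<chi>_add_right[of w c "- (c + d)"] by simp
      ultimately show ?thesis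
        using rep_\<iota>[OF V, of c] rep_\<iota>[OF V, of d]
        by (simp add: mult_smult_distrib[of _ ?n ?n _ ?n] smult_smult)
    qed
    have "snd V (\<iota> c) * weight_proj \<iota> \<chi> V w =
        msum ?n ?n (\<lambda>d. \<chi> w c \<cdot>\<^sub>m ((\<chi> w (- (c + d)) / ?N) \<cdot>\<^sub>m snd V (\<iota> (c + d))))"
      unfolding weight_proj_def using rep_\<iota>[OF V]
      by (subst mult_msum[where p = ?n]) (auto simp: m)
    also have "\<dots> = \<chi> w c \<cdot>\<^sub>m weight_proj \<iota> \<chi> V w"
    proof (rule eq_matI)
      fix i j assume ij: "i < dim_row (\<chi> w c \<cdot>\<^sub>m weight_proj \<iota> \<chi> V w)"
        "j < dim_col (\<chi> w c \<cdot>\<^sub>m weight_proj \<iota> \<chi> V w)"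
      have d: "dim_row (snd V (\<iota> d)) = ?n" "dim_col (snd V (\<iota> d)) = ?n" for d
        using rep_\<iota>[OF V, of d] by auto
      have "(\<Sum>d\<in>UNIV. \<chi> w c * (\<chi> w (- (c + d)) / ?N * snd V (\<iota> (c + d)) $$ (i, j))) =
          (\<Sum>d\<in>UNIV. \<chi> w c * (\<chi> w (- d) / ?N * snd V (\<iota> d) $$ (i, j)))"
        by (rule sum.reindex_bij_witness[where i = "\<lambda>d. d - c" and j = "\<lambda>d. c + d"]) auto
      then show "msum ?n ?n (\<lambda>d. \<chi> w c \<cdot>\<^sub>m ((\<chi> w (- (c + d)) / ?N) \<cdot>\<^sub>m snd V (\<iota> (c + d)))) $$ (i, j)
          = (\<chi> w c \<cdot>\<^sub>m weight_proj \<iota> \<chi> V w) $$ (i, j)"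
        using ij by (simp add: weight_proj_def d sum_distrib_left)
    qed (simp_all add: weight_proj_def)
    finally show ?thesis .
  qed
  then show ?thesis by (simp add: weight_def weight_proj_def)
qed

lemma weight_proj_mult:
  assumes V: "V \<in> reps G" and T: "weight \<iota> \<chi> V w T"
  shows "weight_proj \<iota> \<chi> V x * T = (if x = w then 1 else 0) \<cdot>\<^sub>m T"
proof -
  let ?n = "fst V" and ?N = "of_nat CARD('c) :: complex"
  obtain m where Tc: "T \<in> carrier_mat ?n m" using T by (auto simp: weight_def)
  have e: "((\<chi> x (- c) / ?N) \<cdot>\<^sub>m snd V (\<iota> c)) * T = (\<chi> (w - x) c / ?N) \<cdot>\<^sub>m T" for c
  proof -
    have "\<chi> x (- c) * \<chi> w c = \<chi> (w - x) c"
      using \<chi>_add_left[of "w - x" x c] \<chi>_minus[of x c] by (simp add: mult_ac)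
    moreover have "snd V (\<iota> c) * T = \<chi> w c \<cdot>\<^sub>m T" using T by (simp add: weight_def)
    ultimately show ?thesis
      by (simp only: mult_smult_assoc_mat[OF rep_\<iota>[OF V] Tc] smult_smult times_divide_eq_left)
  qed
  have "weight_proj \<iota> \<chi> V x * T = msum ?n m (\<lambda>c. (\<chi> (w - x) c / ?N) \<cdot>\<^sub>m T)"
    unfolding weight_proj_def e[symmetric] by (rule msum_mult) (simp_all add: rep_\<iota>[OF V] Tc)
  also have "\<dots> = ((\<Sum>c\<in>UNIV. \<chi> (w - x) c) / ?N) \<cdot>\<^sub>m T"
    using Tc by (simp add: msum_smult_const sum_divide_distrib)
  also have "(\<Sum>c\<in>UNIV. \<chi> (w - x) c) / ?N = (if x = w then 1 else 0)"
    using \<chi>_sum_left[of "w - x"] by simp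
  finally show ?thesis .
qed

lemma diag_op_mult:
  assumes V: "V \<in> reps G" and T: "weight \<iota> \<chi> V w T"
  shows "diag_op \<iota> \<chi> V f * T = f w \<cdot>\<^sub>m T"
proof -
  let ?n = "fst V"
  obtain m where Tc: "T \<in> carrier_mat ?n m" using T by (auto simp: weight_def)
  have e: "(f x \<cdot>\<^sub>m weight_proj \<iota> \<chi> V x) * T = (if x = w then 1 else 0) \<cdot>\<^sub>m (f x \<cdot>\<^sub>m T)" for x
    using mult_smult_assoc_mat[OF weight_proj_carrier Tc, of "f x" \<iota> \<chi> x]
    by (simp add: weight_proj_mult[OF V T] smult_smult)
  have "diag_op \<iota> \<chi> V f * T = msum ?n m (\<lambda>x. (if x = w then 1 else 0) \<cdot>\<^sub>m (f x \<cdot>\<^sub>m T))"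
    unfolding diag_op_def e[symmetric] by (rule msum_mult) (simp_all add: Tc)
  also have "\<dots> = f w \<cdot>\<^sub>m T" using Tc by (subst msum_delta) auto
  finally show ?thesis .
qed

text \<open>
  Any operator that commutes with the central subgroup preserves weights; below it is an
  intertwiner or the action of a group element.
\<close>
lemma weight_mult:
  assumes V: "V \<in> reps G" and W: "W \<in> reps G" and T: "weight \<iota> \<chi> V w T"
    and M: "M \<in> carrier_mat (fst W) (fst V)"
    and comm: "\<And>c. snd W (\<iota> c) * M = M * snd V (\<iota> c)"
  shows "weight \<iota> \<chi> W w (M * T)"
proof -
  have Tc: "T \<in> carrier_mat (fst V) (dim_col T)" using T by (auto simp: weight_def)
  have "snd W (\<iota> c) * (M * T) = \<chi> w c \<cdot>\<^sub>m (M * T)" for c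
  proof -
    have "snd W (\<iota> c) * (M * T) = snd W (\<iota> c) * M * T"
      by (rule assoc_mult_mat[symmetric, OF rep_\<iota>[OF W] M Tc])
    also have "\<dots> = M * (snd V (\<iota> c) * T)"
      unfolding comm by (rule assoc_mult_mat[OF M rep_\<iota>[OF V] Tc])
    also have "snd V (\<iota> c) * T = \<chi> w c \<cdot>\<^sub>m T" using T by (simp add: weight_def)
    also have "M * (\<chi> w c \<cdot>\<^sub>m T) = \<chi> w c \<cdot>\<^sub>m (M * T)" by (rule mult_smult_distrib[OF M Tc])
    finally show ?thesis .
  qed
  then show ?thesis using M by (simp add: weight_def)
qed

lemma weight_rep_mult:
  assumes V: "V \<in> reps G" and T: "weight \<iota> \<chi> V w T" and g: "g \<in> carrier G"
  shows "weight \<iota> \<chi> V w (snd V g * T)"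
proof (rule weight_mult[OF V V T reps_carrier[OF V g]])
  fix c
  have "snd V (h \<otimes> k) = snd V h * snd V k" if "h \<in> carrier G" "k \<in> carrier G" for h k
    using V that by (auto simp: reps_def)
  from this[OF \<iota>_closed g] this[OF g \<iota>_closed]
  show "snd V (\<iota> c) * snd V g = snd V g * snd V (\<iota> c)"
    using \<iota>_central[OF g, of c] by metis
qed

text \<open>
  A central element acts diagonally on a tensor product, so characters multiply.  This additivity is
  the only interaction between weights and the tensor product that the twist uses.
\<close>
lemma weight_kron:
  assumes V: "V \<in> reps G" and W: "W \<in> reps G"
    and T: "weight \<iota> \<chi> V w T" and S: "weight \<iota> \<chi> W y S"
  shows "weight \<iota> \<chi> (tensor_rep V W) (w + y) (kron T S)"
proof -
  have Tc: "T \<in> carrier_mat (fst V) (dim_col T)" "S \<in> carrier_mat (fst W) (dim_col S)"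
    using T S by (auto simp: weight_def)
  have "kron (snd V (\<iota> c)) (snd W (\<iota> c)) * kron T S = \<chi> (w + y) c \<cdot>\<^sub>m kron T S" for c
  proof -
    have "snd V (\<iota> c) * T = \<chi> w c \<cdot>\<^sub>m T" "snd W (\<iota> c) * S = \<chi> y c \<cdot>\<^sub>m S"
      using T S by (simp_all add: weight_def)
    then show ?thesis
      by (simp only: kron_mult[symmetric, OF rep_\<iota>[OF V] Tc(1) rep_\<iota>[OF W] Tc(2)]
          smult_kron \<chi>_add_left)
  qed
  then show ?thesis using T S by (simp add: weight_def tensor_rep_def)
qed

lemma weight_eqI:
  assumes V: "V \<in> reps G" and M: "M \<in> carrier_mat m (fst V)" and N: "N \<in> carrier_mat m (fst V)"
    and eq: "\<And>w T. \<lbrakk>weight \<iota> \<chi> V w T; T \<in> carrier_mat (fst V) (fst V)\<rbrakk> \<Longrightarrow> M * T = N * T"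
  shows "M = N"
  by (rule resolution_eqI[OF weight_proj_resolution[OF V] M N])
    (rule eq[OF weight_weight_proj[OF V] weight_proj_carrier])

lemma kron_weight_eqI:
  assumes V: "V \<in> reps G" and W: "W \<in> reps G"
    and M: "M \<in> carrier_mat m (fst V * fst W)" and N: "N \<in> carrier_mat m (fst V * fst W)"
    and eq: "\<And>x y T S. \<lbrakk>weight \<iota> \<chi> V x T; T \<in> carrier_mat (fst V) (fst V);
      weight \<iota> \<chi> W y S; S \<in> carrier_mat (fst W) (fst W)\<rbrakk> \<Longrightarrow> M * kron T S = N * kron T S"
  shows "M = N"
  using resolution_eqI[OF resolution_kron[OF weight_proj_resolution[OF V] weight_proj_resolution[OF W]] M N]
  by (auto intro!: eq weight_weight_proj V W)

lemma kron_kron_weight_eqI: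
  assumes V: "V \<in> reps G" and W: "W \<in> reps G" and U: "U \<in> reps G"
    and M: "M \<in> carrier_mat m (fst V * fst W * fst U)"
    and N: "N \<in> carrier_mat m (fst V * fst W * fst U)"
    and eq: "\<And>x y w T S R. \<lbrakk>weight \<iota> \<chi> V x T; T \<in> carrier_mat (fst V) (fst V);
      weight \<iota> \<chi> W y S; S \<in> carrier_mat (fst W) (fst W);
      weight \<iota> \<chi> U w R; R \<in> carrier_mat (fst U) (fst U)\<rbrakk>
      \<Longrightarrow> M * kron (kron T S) R = N * kron (kron T S) R"
  shows "M = N"
  using resolution_eqI[OF resolution_kron[OF resolution_kron[OF weight_proj_resolution[OF V]
      weight_proj_resolution[OF W]] weight_proj_resolution[OF U]] M N]
  by (auto intro!: eq weight_weight_proj V W U)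

end

section \<open>Twisting by a central cocycle\<close>

definition twist_rep :: "('c::{finite,ab_group_add} \<Rightarrow> 'a) \<Rightarrow> ('x::finite \<Rightarrow> 'c \<Rightarrow> complex)
    \<Rightarrow> ('a \<Rightarrow> 'x \<Rightarrow> complex) \<Rightarrow> 'a rep \<Rightarrow> 'a rep" where
  "twist_rep \<iota> \<chi> z V = (fst V, \<lambda>g. snd V g * diag_op \<iota> \<chi> V (z g))"

lemma fst_twist_rep [simp]: "fst (twist_rep \<iota> \<chi> z V) = fst V"
  by (simp add: twist_rep_def)

text \<open>
  \<open>H\<close> is \<open>G\<close> with its product changed by a cocycle \<open>\<gamma>\<close> with values in the central subgroup.  At a single
  character \<open>x\<close> the scalars \<open>\<lambda>g. z g x\<close> trivialise the complex-valued cocycle \<open>\<lambda>g h. \<chi> x (\<gamma> g h)\<close>; what they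
  need not be is a character in \<open>x\<close>, and this is what leaves room for \<open>H\<close> to differ from \<open>G\<close>.
\<close>
locale central_twist = central_weights G \<iota> \<chi> + H: group H
  for G :: "('a, 'm) monoid_scheme" (structure) and H :: "('a, 'n) monoid_scheme"
    and \<iota> :: "'c::{finite,ab_group_add} \<Rightarrow> 'a"
    and \<chi> :: "'x::{finite,ab_group_add} \<Rightarrow> 'c \<Rightarrow> complex" +
  fixes \<gamma> :: "'a \<Rightarrow> 'a \<Rightarrow> 'c" and z :: "'a \<Rightarrow> 'x \<Rightarrow> complex"
  assumes carrier_eq: "carrier H = carrier G"
    and one_eq: "\<one>\<^bsub>H\<^esub> = \<one>"
    and mult_eq: "\<lbrakk>g \<in> carrier G; h \<in> carrier G\<rbrakk> \<Longrightarrow> g \<otimes>\<^bsub>H\<^esub> h = g \<otimes> h \<otimes> \<iota> (\<gamma> g h)"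
    and \<gamma>_left: "g \<in> carrier G \<Longrightarrow> \<gamma> (\<iota> c) g = 0"
    and \<gamma>_right: "g \<in> carrier G \<Longrightarrow> \<gamma> g (\<iota> c) = 0"
    and z_mult: "\<lbrakk>g \<in> carrier G; h \<in> carrier G\<rbrakk> \<Longrightarrow> z g x * z h x = \<chi> x (\<gamma> g h) * z (g \<otimes> h) x"
    and z_\<iota>: "z (\<iota> c) x = 1"
    and z_zero: "g \<in> carrier G \<Longrightarrow> z g 0 = 1"
    and z_nonzero: "g \<in> carrier G \<Longrightarrow> z g x \<noteq> 0"
begin

abbreviation "twist \<equiv> twist_rep \<iota> \<chi> z"

lemma z_absorb: "g \<in> carrier G \<Longrightarrow> z (g \<otimes> \<iota> c) x = z g x"
  using z_mult[of g "\<iota> c" x] by (simp add: \<gamma>_right z_\<iota>)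

text \<open>
  The hypotheses are symmetric in \<open>G\<close> and \<open>H\<close>.  Hence the quasi-inverse of the twist is again a twist, and
  everything proved about twists applies to it.
\<close>
lemma inverse_twist: "central_twist H G \<iota> \<chi> (\<lambda>g h. - \<gamma> g h) (\<lambda>g x. 1 / z g x)"
proof
  have c: "g \<otimes>\<^bsub>H\<^esub> \<iota> c = g \<otimes> \<iota> c" "\<iota> c \<otimes>\<^bsub>H\<^esub> g = \<iota> c \<otimes> g" if "g \<in> carrier G" for g c
    using that by (simp_all add: mult_eq \<gamma>_left \<gamma>_right)
  have zH: "z (g \<otimes>\<^bsub>H\<^esub> h) x = z (g \<otimes> h) x" if "g \<in> carrier G" "h \<in> carrier G" for g h x
    using that by (simp add: mult_eq z_absorb)
  fix g h x c d
  show "\<iota> c \<in> carrier H" by (simp add: carrier_eq)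
  show "\<iota> (c + d) = \<iota> c \<otimes>\<^bsub>H\<^esub> \<iota> d" by (simp add: c \<iota>_add)
  show "carrier G = carrier H" "\<one> = \<one>\<^bsub>H\<^esub>" by (simp_all add: carrier_eq one_eq)
  show "1 / z (\<iota> c) x = 1" by (simp add: z_\<iota>)
  {
    assume "g \<in> carrier H"
    then have g: "g \<in> carrier G" by (simp add: carrier_eq)
    show "\<iota> c \<otimes>\<^bsub>H\<^esub> g = g \<otimes>\<^bsub>H\<^esub> \<iota> c" using g by (simp add: c \<iota>_central)
    show "- \<gamma> (\<iota> c) g = 0" "- \<gamma> g (\<iota> c) = 0" using g by (simp_all add: \<gamma>_left \<gamma>_right)
    show "1 / z g 0 = 1" "1 / z g x \<noteq> 0" using g by (simp_all add: z_zero z_nonzero)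
    assume "h \<in> carrier H"
    then have h: "h \<in> carrier G" by (simp add: carrier_eq)
    have "g \<otimes> h \<otimes> \<iota> (\<gamma> g h) \<otimes> \<iota> (- \<gamma> g h) = g \<otimes> h"
      using g h \<iota>_add[of "\<gamma> g h" "- \<gamma> g h"] by (simp add: m_assoc flip: \<iota>_add)
    then show "g \<otimes> h = g \<otimes>\<^bsub>H\<^esub> h \<otimes>\<^bsub>H\<^esub> \<iota> (- \<gamma> g h)"
      using g h c(1)[of "g \<otimes>\<^bsub>H\<^esub> h" "- \<gamma> g h"] by (simp add: mult_eq)
    show "1 / z g x * (1 / z h x) = \<chi> x (- \<gamma> g h) * (1 / z (g \<otimes>\<^bsub>H\<^esub> h) x)"
      using g h z_mult[OF g h, of x] \<chi>_minus[of x "\<gamma> g h"] z_nonzero[of g x] z_nonzero[of h x]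
        z_nonzero[of "g \<otimes> h" x]
      by (simp add: zH divide_simps) auto
  }
qed (fact \<chi>_zero_left \<chi>_zero_right \<chi>_add_left \<chi>_add_right \<chi>_sum_left \<chi>_sum_right card_dual)+

text \<open>
  The working form of the definition of the twist: it is a scalar on each weight.
\<close>
lemma twist_mult:
  assumes V: "V \<in> reps G" and T: "weight \<iota> \<chi> V w T" and g: "g \<in> carrier G"
  shows "snd (twist V) g * T = z g w \<cdot>\<^sub>m (snd V g * T)"
proof -
  obtain m where Tc: "T \<in> carrier_mat (fst V) m" using T by (auto simp: weight_def)
  have "snd (twist V) g * T = snd V g * (diag_op \<iota> \<chi> V (z g) * T)"
    unfolding twist_rep_def snd_conv by (rule assoc_mult_mat[OF reps_carrier[OF V g] diag_op_carrier Tc])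
  also have "\<dots> = snd V g * (z g w \<cdot>\<^sub>m T)" by (simp only: diag_op_mult[OF V T])
  also have "\<dots> = z g w \<cdot>\<^sub>m (snd V g * T)" by (rule mult_smult_distrib[OF reps_carrier[OF V g] Tc])
  finally show ?thesis .
qed

lemma twist_carrier:
  assumes "V \<in> reps G" "g \<in> carrier G"
  shows "snd (twist V) g \<in> carrier_mat (fst V) (fst V)"
  using reps_carrier[OF assms] by (simp add: twist_rep_def mult_carrier_mat[of _ _ "fst V"])

lemma weight_twist:
  assumes V: "V \<in> reps G" and T: "weight \<iota> \<chi> V w T"
  shows "weight \<iota> \<chi> (twist V) w T"
proof -
  have "snd (twist V) (\<iota> c) * T = \<chi> w c \<cdot>\<^sub>m T" for c
    using T by (simp add: twist_mult[OF V T] z_\<iota>) (simp add: weight_def)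
  then show ?thesis using T by (simp add: weight_def)
qed

lemma reps_mult_\<iota>:
  assumes V: "V \<in> reps G" and T: "weight \<iota> \<chi> V w T" and g: "g \<in> carrier G"
  shows "snd V (g \<otimes> \<iota> c) * T = \<chi> w c \<cdot>\<^sub>m (snd V g * T)"
proof -
  obtain m where Tc: "T \<in> carrier_mat (fst V) m" using T by (auto simp: weight_def)
  have "snd V (g \<otimes> \<iota> c) * T = snd V g * (snd V (\<iota> c) * T)"
    unfolding reps_mult[OF V g \<iota>_closed]
    by (rule assoc_mult_mat[OF reps_carrier[OF V g] rep_\<iota>[OF V] Tc])
  also have "snd V (\<iota> c) * T = \<chi> w c \<cdot>\<^sub>m T" using T by (simp add: weight_def)
  also have "snd V g * \<dots> = \<chi> w c \<cdot>\<^sub>m (snd V g * T)"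
    by (rule mult_smult_distrib[OF reps_carrier[OF V g] Tc])
  finally show ?thesis .
qed

text \<open>
  On weight \<open>w\<close> the central factor \<open>\<iota> (\<gamma> g h)\<close> of the product in \<open>H\<close> contributes the scalar \<open>\<chi> w (\<gamma> g h)\<close>,
  which is exactly the defect of multiplicativity of \<open>z\<close>.
\<close>
lemma twist_reps:
  assumes V: "V \<in> reps G"
  shows "twist V \<in> reps H"
proof -
  let ?n = "fst V"
  have "snd (twist V) \<one>\<^bsub>H\<^esub> = 1\<^sub>m ?n"
  proof (rule weight_eqI[OF V, where m = ?n])
    fix w T assume T: "weight \<iota> \<chi> V w T" "T \<in> carrier_mat ?n ?n"
    show "snd (twist V) \<one>\<^bsub>H\<^esub> * T = 1\<^sub>m ?n * T"
      using T z_\<iota>[of 0 w] by (simp add: one_eq twist_mult[OF V] reps_one[OF V])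
  qed (simp_all add: one_eq twist_carrier[OF V])
  moreover have "snd (twist V) (g \<otimes>\<^bsub>H\<^esub> h) = snd (twist V) g * snd (twist V) h"
    if g: "g \<in> carrier G" and h: "h \<in> carrier G" for g h
  proof (rule weight_eqI[OF V])
    have gh: "g \<otimes>\<^bsub>H\<^esub> h \<in> carrier G" using g h by (simp add: mult_eq)
    show "snd (twist V) (g \<otimes>\<^bsub>H\<^esub> h) \<in> carrier_mat ?n ?n" by (rule twist_carrier[OF V gh])
    show "snd (twist V) g * snd (twist V) h \<in> carrier_mat ?n ?n"
      by (rule mult_carrier_mat[OF twist_carrier[OF V g] twist_carrier[OF V h]])
    fix w T assume T: "weight \<iota> \<chi> V w T" and Tc: "T \<in> carrier_mat ?n ?n"
    note r = reps_carrier[OF V g] reps_carrier[OF V h]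
    have "snd (twist V) (g \<otimes>\<^bsub>H\<^esub> h) * T
        = (z (g \<otimes> h) w * \<chi> w (\<gamma> g h)) \<cdot>\<^sub>m (snd V (g \<otimes> h) * T)"
      unfolding twist_mult[OF V T gh] using g h
      by (simp add: mult_eq z_absorb reps_mult_\<iota>[OF V T] smult_smult)
    also have "snd V (g \<otimes> h) * T = snd V g * (snd V h * T)"
      unfolding reps_mult[OF V g h] by (rule assoc_mult_mat[OF r Tc])
    also have "(z (g \<otimes> h) w * \<chi> w (\<gamma> g h)) \<cdot>\<^sub>m (snd V g * (snd V h * T))
        = (z h w * z g w) \<cdot>\<^sub>m (snd V g * (snd V h * T))"
      using z_mult[OF g h, of w] by (simp add: mult_ac)
    also have "\<dots> = z h w \<cdot>\<^sub>m (snd (twist V) g * (snd V h * T))"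
      by (simp add: twist_mult[OF V weight_rep_mult[OF V T h] g] smult_smult)
    also have "\<dots> = snd (twist V) g * (z h w \<cdot>\<^sub>m (snd V h * T))"
      by (rule mult_smult_distrib[symmetric, OF twist_carrier[OF V g] mult_carrier_mat[OF r(2) Tc]])
    also have "\<dots> = snd (twist V) g * (snd (twist V) h * T)"
      by (simp only: twist_mult[OF V T h])
    also have "\<dots> = snd (twist V) g * snd (twist V) h * T"
      by (rule assoc_mult_mat[symmetric, OF twist_carrier[OF V g] twist_carrier[OF V h] Tc])
    finally show "snd (twist V) (g \<otimes>\<^bsub>H\<^esub> h) * T = snd (twist V) g * snd (twist V) h * T" .
  qed
  ultimately show ?thesis
    using twist_carrier[OF V] by (simp add: reps_def carrier_eq case_prod_unfold)
qed

text \<open>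
  Intertwiners preserve weights, so they commute with the scalars; the functor can therefore be
  the identity on morphisms.
\<close>
lemma twist_intertwiners:
  assumes V: "V \<in> reps G" and W: "W \<in> reps G" and S: "S \<in> intertwiners G V W"
  shows "S \<in> intertwiners H (twist V) (twist W)"
proof -
  note Sc = intertwiners_carrier[OF S]
  have comm: "S * snd V g = snd W g * S" if "g \<in> carrier G" for g
    using S that by (simp add: intertwiners_def)
  have "S * snd (twist V) g = snd (twist W) g * S" if g: "g \<in> carrier G" for g
  proof (rule weight_eqI[OF V])
    note c = twist_carrier[OF V g] twist_carrier[OF W g] reps_carrier[OF V g] reps_carrier[OF W g]
    show "S * snd (twist V) g \<in> carrier_mat (fst W) (fst V)"
      "snd (twist W) g * S \<in> carrier_mat (fst W) (fst V)"
      using Sc c by (auto intro: mult_carrier_mat)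
    fix w T assume T: "weight \<iota> \<chi> V w T" and Tc: "T \<in> carrier_mat (fst V) (fst V)"
    have ST: "weight \<iota> \<chi> W w (S * T)"
      by (rule weight_mult[OF V W T Sc]) (simp add: comm)
    have "S * snd (twist V) g * T = S * (snd (twist V) g * T)"
      by (rule assoc_mult_mat[OF Sc c(1) Tc])
    also have "\<dots> = z g w \<cdot>\<^sub>m (S * (snd V g * T))"
      unfolding twist_mult[OF V T g] by (rule mult_smult_distrib[OF Sc mult_carrier_mat[OF c(3) Tc]])
    also have "S * (snd V g * T) = S * snd V g * T" by (rule assoc_mult_mat[symmetric, OF Sc c(3) Tc])
    also have "\<dots> = snd W g * (S * T)" unfolding comm[OF g] by (rule assoc_mult_mat[OF c(4) Sc Tc])
    also have "z g w \<cdot>\<^sub>m \<dots> = snd (twist W) g * (S * T)" by (rule twist_mult[symmetric, OF W ST g])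
    also have "\<dots> = snd (twist W) g * S * T" by (rule assoc_mult_mat[symmetric, OF c(2) Sc Tc])
    finally show "S * snd (twist V) g * T = snd (twist W) g * S * T" .
  qed
  then show ?thesis using Sc by (simp add: intertwiners_def carrier_eq)
qed

lemma twist_functor: "cat_functor (Rep G) (Rep H) twist (\<lambda>_ _ S. S)"
proof -
  interpret C: category "Rep G" by (rule category_Rep)
  interpret D: category "Rep H" by (rule category_Rep)
  show ?thesis
    by unfold_locales (simp_all add: Rep_simps twist_reps twist_intertwiners)
qed

lemma twist_inverse:
  assumes V: "V \<in> reps G" and g: "g \<in> carrier G"
  shows "snd (twist_rep \<iota> \<chi> (\<lambda>g x. 1 / z g x) (twist V)) g = snd V g"
proof (rule weight_eqI[OF V])
  interpret inv: central_twist H G \<iota> \<chi> "\<lambda>g h. - \<gamma> g h" "\<lambda>g x. 1 / z g x" by (rule inverse_twist)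
  have g': "g \<in> carrier H" using g by (simp add: carrier_eq)
  show "snd (inv.twist (twist V)) g \<in> carrier_mat (fst V) (fst V)"
    using inv.twist_carrier[OF twist_reps[OF V] g'] by simp
  show "snd V g \<in> carrier_mat (fst V) (fst V)" by (rule reps_carrier[OF V g])
  fix w T assume T: "weight \<iota> \<chi> V w T" and Tc: "T \<in> carrier_mat (fst V) (fst V)"
  show "snd (inv.twist (twist V)) g * T = snd V g * T"
    by (simp add: inv.twist_mult[OF twist_reps[OF V] weight_twist[OF V T] g'] twist_mult[OF V T g]
        smult_smult z_nonzero[OF g])
qed

text \<open>
  The two composites of the twists agree with the identity functors on the carrier of the group,
  but possibly not outside it, so the identity matrices serve as natural isomorphisms.
\<close>
lemma twist_equivalence: "cat_equivalence (Rep G) (Rep H) twist (\<lambda>_ _ S. S)"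
proof -
  interpret inv: central_twist H G \<iota> \<chi> "\<lambda>g h. - \<gamma> g h" "\<lambda>g x. 1 / z g x" by (rule inverse_twist)
  interpret cat_functor "Rep G" "Rep H" twist "\<lambda>_ _ S. S" by (rule twist_functor)
  have 1: "natural_iso (Rep G) (Rep G) (\<lambda>a. a) (\<lambda>a b f. f) (\<lambda>a. inv.twist (twist a)) (\<lambda>a b f. f)
      (\<lambda>V. 1\<^sub>m (fst V))"
  proof -
    have "cat_iso (Rep G) V (inv.twist (twist V)) (1\<^sub>m (fst V))" if "V \<in> reps G" for V
      by (rule cat_iso_Rep_one[OF reps_carrier[OF that]]) (simp_all add: twist_inverse that)
    then show ?thesis
      unfolding natural_iso_def by (auto simp: Rep_simps dest!: intertwiners_carrier)
  qed
  have inv_inv: "snd (twist (inv.twist V)) g = snd V g" if "V \<in> reps H" "g \<in> carrier H" for V g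
    using inv.twist_inverse[OF that] by simp
  have 2: "natural_iso (Rep H) (Rep H) (\<lambda>a. twist (inv.twist a)) (\<lambda>a b f. f) (\<lambda>a. a) (\<lambda>a b f. f)
      (\<lambda>V. 1\<^sub>m (fst V))"
  proof -
    have "cat_iso (Rep H) (twist (inv.twist V)) V (1\<^sub>m (fst V))" if V: "V \<in> reps H" for V
    proof (rule cat_iso_Rep_one)
      fix g assume g: "g \<in> carrier H"
      show "snd V g = snd (twist (inv.twist V)) g" by (simp add: inv_inv[OF V g])
      then show "snd (twist (inv.twist V)) g \<in> carrier_mat (fst V) (fst V)"
        using reps_carrier[OF V g] by simp
    qed simp_all
    then show ?thesis
      unfolding natural_iso_def by (auto simp: Rep_simps dest!: intertwiners_carrier)
  qed
  show ?thesis
    by unfold_locales (use inv.twist_functor 1 2 in blast)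
qed

end

section \<open>The monoidal structure of the twist\<close>

text \<open>
  With \<open>v = u\<close> this is the image of the twist \<open>\<Sum>\<^sub>y u y \<otimes> e\<^sub>y\<close> in the tensor square of the group algebra of \<open>G\<close>,
  where \<open>e\<^sub>y\<close> is the idempotent of the character \<open>y\<close>.  The function \<open>v\<close> is a parameter because the inverse
  has the same form.
\<close>
definition tensorator :: "('c::{finite,ab_group_add} \<Rightarrow> 'a) \<Rightarrow> ('x::finite \<Rightarrow> 'c \<Rightarrow> complex)
    \<Rightarrow> ('x \<Rightarrow> 'a) \<Rightarrow> 'a rep \<Rightarrow> 'a rep \<Rightarrow> complex mat" where
  "tensorator \<iota> \<chi> v V W = msum (fst V * fst W) (fst V * fst W)
     (\<lambda>y. kron (snd V (v y)) (weight_proj \<iota> \<chi> W y))"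

lemma tensorator_carrier [simp, intro]:
  "tensorator \<iota> \<chi> v V W \<in> carrier_mat (fst V * fst W) (fst V * fst W)"
  by (simp add: tensorator_def)

text \<open>
  The weight of a tensor product is the sum of the weights, whereas \<open>z g\<close> need not be a character, so the twist
  of a tensor product need not be the tensor product of the twists.  The last two assumptions say that the
  defect is visible inside \<open>G\<close>: it is the character \<open>x\<close> evaluated at the commutator of \<open>g\<close> with
  an element \<open>u y\<close>.
\<close>
locale monoidal_twist = central_twist G H \<iota> \<chi> \<gamma> z
  for G :: "('a, 'm) monoid_scheme" (structure) and H :: "('a, 'n) monoid_scheme"
    and \<iota> :: "'c::{finite,ab_group_add} \<Rightarrow> 'a"
    and \<chi> :: "'x::{finite,ab_group_add} \<Rightarrow> 'c \<Rightarrow> complex"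
    and \<gamma> :: "'a \<Rightarrow> 'a \<Rightarrow> 'c" and z :: "'a \<Rightarrow> 'x \<Rightarrow> complex" +
  fixes u :: "'x \<Rightarrow> 'a" and \<kappa> :: "'a \<Rightarrow> 'x \<Rightarrow> 'c"
  assumes u_closed [simp]: "u y \<in> carrier G"
    and u_add: "u (x + y) = u x \<otimes> u y"
    and u_commute: "g \<in> carrier G \<Longrightarrow> u y \<otimes> g = g \<otimes> u y \<otimes> \<iota> (\<kappa> g y)"
    and z_add: "g \<in> carrier G \<Longrightarrow> z g (x + y) = \<chi> x (\<kappa> g y) * (z g x * z g y)"
begin

lemma u_zero: "u 0 = \<one>"
  using u_add[of 0 0] by (simp add: l_cancel_one)

text \<open>
  On a right factor of weight \<open>y\<close> only one summand survives, and it applies \<open>u y\<close> to the left factor.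
\<close>
lemma tensorator_kron:
  assumes V: "V \<in> reps G" and W: "W \<in> reps G" and v: "\<And>y. v y \<in> carrier G"
    and T: "T \<in> carrier_mat (fst V) m" and S: "weight \<iota> \<chi> W y S" "S \<in> carrier_mat (fst W) n"
  shows "tensorator \<iota> \<chi> v V W * kron T S = kron (snd V (v y) * T) S"
proof -
  let ?n = "fst V * fst W"
  have t: "kron (snd V (v x)) (weight_proj \<iota> \<chi> W x) * kron T S
      = (if x = y then 1 else 0) \<cdot>\<^sub>m kron (snd V (v x) * T) S" for x
    unfolding kron_mult[symmetric, OF reps_carrier[OF V v] T weight_proj_carrier S(2)]
      weight_proj_mult[OF W S(1)]
    using smult_kron[of 1 "snd V (v x) * T" "if x = y then 1 else 0" S] by simp
  have "tensorator \<iota> \<chi> v V W * kron T S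
      = msum ?n (m * n) (\<lambda>x. kron (snd V (v x)) (weight_proj \<iota> \<chi> W x) * kron T S)"
    unfolding tensorator_def
    by (rule msum_mult) (use T S(2) reps_carrier[OF V v] in auto)
  also have "\<dots> = kron (snd V (v y) * T) S"
    unfolding t by (rule msum_delta)
      (intro kron_carrier mult_carrier_mat[OF reps_carrier[OF V v] T] S(2))
  finally show ?thesis .
qed

abbreviation "J \<equiv> tensorator \<iota> \<chi> u"
abbreviation "J' \<equiv> tensorator \<iota> \<chi> (\<lambda>y. u (- y))"

lemma u_minus: "u (- y) \<otimes> u y = \<one>" "u y \<otimes> u (- y) = \<one>"
  using u_add[of "- y" y] u_add[of y "- y"] by (simp_all add: u_zero)

lemma tensorator_inverse:
  assumes V: "V \<in> reps G" and W: "W \<in> reps G"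
  shows "J' V W * J V W = 1\<^sub>m (fst V * fst W)" "J V W * J' V W = 1\<^sub>m (fst V * fst W)"
proof -
  have *: "tensorator \<iota> \<chi> v V W * tensorator \<iota> \<chi> v' V W = 1\<^sub>m (fst V * fst W)"
    if v: "\<And>y. v y \<in> carrier G" "\<And>y. v' y \<in> carrier G" "\<And>y. v y \<otimes> v' y = \<one>" for v v'
  proof (rule kron_weight_eqI[OF V W])
    show "tensorator \<iota> \<chi> v V W * tensorator \<iota> \<chi> v' V W \<in> carrier_mat (fst V * fst W) (fst V * fst W)"
      by (rule mult_carrier_mat[OF tensorator_carrier tensorator_carrier])
    fix x y T S
    assume T: "(T :: complex mat) \<in> carrier_mat (fst V) (fst V)" and S: "weight \<iota> \<chi> W y S" "S \<in> carrier_mat (fst W) (fst W)"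
    note r = reps_carrier[OF V v(1)] reps_carrier[OF V v(2)]
    have "snd V (v y) * (snd V (v' y) * T) = T"
      using assoc_mult_mat[OF r T, of y y, symmetric] T
      by (simp add: v(3) reps_one[OF V] flip: reps_mult[OF V v(1) v(2)])
    then have "tensorator \<iota> \<chi> v V W * (tensorator \<iota> \<chi> v' V W * kron T S) = kron T S"
      unfolding tensorator_kron[OF V W v(2) T S]
        tensorator_kron[OF V W v(1) mult_carrier_mat[OF r(2) T] S] by simp
    then show "tensorator \<iota> \<chi> v V W * tensorator \<iota> \<chi> v' V W * kron T S = 1\<^sub>m (fst V * fst W) * kron T S"
      using assoc_mult_mat[OF tensorator_carrier tensorator_carrier kron_carrier[OF T S(2)]]
        left_mult_one_mat[OF kron_carrier[OF T S(2)]] by metis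
  qed simp
  show "J' V W * J V W = 1\<^sub>m (fst V * fst W)" "J V W * J' V W = 1\<^sub>m (fst V * fst W)"
    by (rule *; simp add: u_minus)+
qed

lemma tensor_reps: "V \<in> reps G \<Longrightarrow> W \<in> reps G \<Longrightarrow> tensor_rep V W \<in> reps G"
  by (rule tensor_rep_reps[OF is_monoid])

text \<open>
  On weights \<open>x\<close> and \<open>y\<close> both sides are multiples of one matrix.  The left side collects \<open>z g x * z g y\<close> and,
  from moving \<open>u y\<close> past \<open>g\<close>, the commutator factor \<open>\<chi> x (\<kappa> g y)\<close>; the right side collects \<open>z g (x + y)\<close>.
\<close>
lemma tensorator_commute:
  assumes V: "V \<in> reps G" and W: "W \<in> reps G" and g: "g \<in> carrier G"
  shows "J V W * kron (snd (twist V) g) (snd (twist W) g) = snd (twist (tensor_rep V W)) g * J V W"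
proof (rule kron_weight_eqI[OF V W])
  let ?n = "fst V * fst W"
  note VW = tensor_reps[OF V W]
  note r = reps_carrier[OF V g] reps_carrier[OF W g] reps_carrier[OF V u_closed]
  note t = twist_carrier[OF V g] twist_carrier[OF W g]
  have tt: "snd (twist (tensor_rep V W)) g \<in> carrier_mat ?n ?n"
    using twist_carrier[OF VW g] by simp
  show "J V W * kron (snd (twist V) g) (snd (twist W) g) \<in> carrier_mat ?n ?n"
    by (rule mult_carrier_mat[OF tensorator_carrier kron_carrier[OF t]])
  show "snd (twist (tensor_rep V W)) g * J V W \<in> carrier_mat ?n ?n"
    by (rule mult_carrier_mat[OF tt tensorator_carrier])
  fix x y T S
  assume T: "weight \<iota> \<chi> V x T" "T \<in> carrier_mat (fst V) (fst V)"
    and S: "weight \<iota> \<chi> W y S" "S \<in> carrier_mat (fst W) (fst W)"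
  have uT: "weight \<iota> \<chi> V x (snd V (u y) * T)" by (rule weight_rep_mult[OF V T(1) u_closed])
  have gS: "weight \<iota> \<chi> W y (snd W g * S)" by (rule weight_rep_mult[OF W S(1) g])
  note gSc = mult_carrier_mat[OF r(2) S(2)] and gTc = mult_carrier_mat[OF r(1) T(2)]
    and uTc = mult_carrier_mat[OF r(3) T(2)]
  have swap: "snd V (u y) * (snd V g * T) = \<chi> x (\<kappa> g y) \<cdot>\<^sub>m (snd V g * (snd V (u y) * T))"
  proof -
    have "snd V (u y) * (snd V g * T) = snd V (u y \<otimes> g) * T"
      unfolding reps_mult[OF V u_closed g] by (rule assoc_mult_mat[symmetric, OF r(3) r(1) T(2)])
    also have "\<dots> = \<chi> x (\<kappa> g y) \<cdot>\<^sub>m (snd V (g \<otimes> u y) * T)"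
      unfolding u_commute[OF g] using g by (intro reps_mult_\<iota>[OF V T(1)]) simp
    also have "snd V (g \<otimes> u y) * T = snd V g * (snd V (u y) * T)"
      unfolding reps_mult[OF V g u_closed] by (rule assoc_mult_mat[OF r(1) r(3) T(2)])
    finally show ?thesis .
  qed
  have "J V W * kron (snd (twist V) g) (snd (twist W) g) * kron T S
      = J V W * kron (snd (twist V) g * T) (snd (twist W) g * S)"
    using assoc_mult_mat[OF tensorator_carrier kron_carrier[OF t] kron_carrier[OF T(2) S(2)]]
      kron_mult[OF t(1) T(2) t(2) S(2)] by metis
  also have "\<dots> = J V W * ((z g x * z g y) \<cdot>\<^sub>m kron (snd V g * T) (snd W g * S))"
    by (simp only: twist_mult[OF V T(1) g] twist_mult[OF W S(1) g] smult_kron)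
  also have "\<dots> = (z g x * z g y) \<cdot>\<^sub>m (J V W * kron (snd V g * T) (snd W g * S))"
    by (rule mult_smult_distrib[OF tensorator_carrier kron_carrier[OF gTc gSc]])
  also have "J V W * kron (snd V g * T) (snd W g * S)
      = \<chi> x (\<kappa> g y) \<cdot>\<^sub>m kron (snd V g * (snd V (u y) * T)) (snd W g * S)"
    unfolding tensorator_kron[OF V W u_closed gTc gS gSc] swap
    using smult_kron[of "\<chi> x (\<kappa> g y)" "snd V g * (snd V (u y) * T)" 1 "snd W g * S"] by simp
  also have "(z g x * z g y) \<cdot>\<^sub>m \<dots> = z g (x + y) \<cdot>\<^sub>m kron (snd V g * (snd V (u y) * T)) (snd W g * S)"
    by (simp add: smult_smult z_add[OF g] mult_ac)
  also have "kron (snd V g * (snd V (u y) * T)) (snd W g * S)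
      = snd (tensor_rep V W) g * kron (snd V (u y) * T) S"
    unfolding tensor_rep_def snd_conv by (rule kron_mult[OF r(1) uTc r(2) S(2)])
  also have "z g (x + y) \<cdot>\<^sub>m \<dots> = snd (twist (tensor_rep V W)) g * kron (snd V (u y) * T) S"
    by (rule twist_mult[symmetric, OF VW weight_kron[OF V W uT S(1)] g])
  also have "\<dots> = snd (twist (tensor_rep V W)) g * (J V W * kron T S)"
    by (simp only: tensorator_kron[OF V W u_closed T(2) S])
  also have "\<dots> = snd (twist (tensor_rep V W)) g * J V W * kron T S"
    by (rule assoc_mult_mat[symmetric, OF tt tensorator_carrier kron_carrier[OF T(2) S(2)]])
  finally show "J V W * kron (snd (twist V) g) (snd (twist W) g) * kron T S
      = snd (twist (tensor_rep V W)) g * J V W * kron T S" .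
qed

lemma tensorator_iso:
  assumes V: "V \<in> reps G" and W: "W \<in> reps G"
  shows "cat_iso (Rep H) (tensor_rep (twist V) (twist W)) (twist (tensor_rep V W)) (J V W)"
proof -
  let ?n = "fst V * fst W"
  note inv = tensorator_inverse[OF V W]
  have "J' V W * snd (twist (tensor_rep V W)) g = kron (snd (twist V) g) (snd (twist W) g) * J' V W"
    if g: "g \<in> carrier G" for g
  proof -
    let ?K = "kron (snd (twist V) g) (snd (twist W) g)" and ?N = "snd (twist (tensor_rep V W)) g"
    have K: "?K \<in> carrier_mat ?n ?n" by (rule kron_carrier[OF twist_carrier[OF V g] twist_carrier[OF W g]])
    have N: "?N \<in> carrier_mat ?n ?n" using twist_carrier[OF tensor_reps[OF V W] g] by simp
    have JV: "J V W \<in> carrier_mat ?n ?n" "J' V W \<in> carrier_mat ?n ?n" by simp_all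
    have "J' V W * ?N = J' V W * (?N * (J V W * J' V W))" using N by (simp add: inv)
    also have "\<dots> = J' V W * (?N * J V W * J' V W)"
      by (simp only: assoc_mult_mat[OF N JV])
    also have "\<dots> = J' V W * (J V W * ?K * J' V W)" by (simp only: tensorator_commute[OF V W g])
    also have "\<dots> = J' V W * (J V W * (?K * J' V W))"
      using assoc_mult_mat[OF JV(1) K JV(2)] by simp
    also have "\<dots> = J' V W * J V W * (?K * J' V W)"
      by (rule assoc_mult_mat[symmetric, OF JV(2) JV(1) mult_carrier_mat[OF K JV(2)]])
    also have "\<dots> = ?K * J' V W" unfolding inv by (rule left_mult_one_mat[OF mult_carrier_mat[OF K JV(2)]])
    finally show ?thesis .
  qed
  then have "J' V W \<in> intertwiners H (twist (tensor_rep V W)) (tensor_rep (twist V) (twist W))"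
    by (simp add: intertwiners_def carrier_eq tensor_rep_def[of "twist V"])
  moreover have "J V W \<in> intertwiners H (tensor_rep (twist V) (twist W)) (twist (tensor_rep V W))"
    by (simp add: intertwiners_def carrier_eq tensor_rep_def[of "twist V"] tensorator_commute[OF V W])
  ultimately show ?thesis
    unfolding cat_iso_def Rep_simps by (auto simp: inv intro!: bexI[of _ "J' V W"])
qed

lemma tensorator_natural:
  assumes V: "V \<in> reps G" and W: "W \<in> reps G" and V': "V' \<in> reps G" and W': "W' \<in> reps G"
    and f: "f \<in> intertwiners G V V'" and h: "h \<in> intertwiners G W W'"
  shows "kron f h * J V W = J V' W' * kron f h"
proof (rule kron_weight_eqI[OF V W])
  note c = intertwiners_carrier[OF f] intertwiners_carrier[OF h]
  show "kron f h * J V W \<in> carrier_mat (fst V' * fst W') (fst V * fst W)"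
    by (rule mult_carrier_mat[OF kron_carrier[OF c] tensorator_carrier])
  show "J V' W' * kron f h \<in> carrier_mat (fst V' * fst W') (fst V * fst W)"
    by (rule mult_carrier_mat[OF tensorator_carrier kron_carrier[OF c]])
  fix x y T S
  assume T: "(T :: complex mat) \<in> carrier_mat (fst V) (fst V)" and S: "weight \<iota> \<chi> W y S" "S \<in> carrier_mat (fst W) (fst W)"
  have hS: "weight \<iota> \<chi> W' y (h * S)"
    using h by (intro weight_mult[OF W W' S(1) c(2)]) (simp add: intertwiners_def)
  note r = reps_carrier[OF V u_closed] reps_carrier[OF V' u_closed]
  have "kron f h * J V W * kron T S = kron f h * (J V W * kron T S)"
    by (rule assoc_mult_mat[OF kron_carrier[OF c] tensorator_carrier kron_carrier[OF T S(2)]])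
  also have "J V W * kron T S = kron (snd V (u y) * T) S"
    by (rule tensorator_kron[OF V W u_closed T S])
  also have "kron f h * \<dots> = kron (f * (snd V (u y) * T)) (h * S)"
    by (rule kron_mult[symmetric, OF c(1) mult_carrier_mat[OF r(1) T] c(2) S(2)])
  also have "f * (snd V (u y) * T) = f * snd V (u y) * T"
    by (rule assoc_mult_mat[symmetric, OF c(1) r(1) T])
  also have "\<dots> = snd V' (u y) * f * T" using f by (simp add: intertwiners_def)
  also have "\<dots> = snd V' (u y) * (f * T)" by (rule assoc_mult_mat[OF r(2) c(1) T])
  also have "kron \<dots> (h * S) = J V' W' * kron (f * T) (h * S)"
    by (rule tensorator_kron[symmetric, OF V' W' u_closed mult_carrier_mat[OF c(1) T] hS
        mult_carrier_mat[OF c(2) S(2)]])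
  also have "\<dots> = J V' W' * (kron f h * kron T S)" by (simp only: kron_mult[OF c(1) T c(2) S(2)])
  also have "\<dots> = J V' W' * kron f h * kron T S"
    by (rule assoc_mult_mat[symmetric, OF tensorator_carrier kron_carrier[OF c] kron_carrier[OF T S(2)]])
  finally show "kron f h * J V W * kron T S = J V' W' * kron f h * kron T S" .
qed

text \<open>
  On weights \<open>y\<close> and \<open>w\<close> of the second and third factor, both sides apply \<open>u w\<close> to the second factor; to the
  first one the left side applies \<open>u w * u y\<close> and the right side \<open>u (y + w)\<close>, so coherence is the
  homomorphism property of \<open>u\<close>.
\<close>
lemma tensorator_assoc:
  assumes V: "V \<in> reps G" and W: "W \<in> reps G" and U: "U \<in> reps G"
  shows "J (tensor_rep V W) U * kron (J V W) (1\<^sub>m (fst U))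
    = J V (tensor_rep W U) * kron (1\<^sub>m (fst V)) (J W U)"
proof (rule kron_kron_weight_eqI[OF V W U])
  let ?n = "fst V * fst W * fst U"
  have c: "J (tensor_rep V W) U \<in> carrier_mat ?n ?n"
    "kron (J V W) (1\<^sub>m (fst U)) \<in> carrier_mat ?n ?n"
    "J V (tensor_rep W U) \<in> carrier_mat ?n ?n"
    "kron (1\<^sub>m (fst V)) (J W U) \<in> carrier_mat ?n ?n"
    using tensorator_carrier[of \<iota> \<chi> u "tensor_rep V W" U] tensorator_carrier[of \<iota> \<chi> u V "tensor_rep W U"]
      kron_carrier[OF tensorator_carrier[of \<iota> \<chi> u V W] one_carrier_mat[of "fst U"]]
      kron_carrier[OF one_carrier_mat[of "fst V"] tensorator_carrier[of \<iota> \<chi> u W U]]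
    by (simp_all add: mult.assoc)
  show "J (tensor_rep V W) U * kron (J V W) (1\<^sub>m (fst U)) \<in> carrier_mat ?n ?n"
    by (rule mult_carrier_mat[OF c(1,2)])
  show "J V (tensor_rep W U) * kron (1\<^sub>m (fst V)) (J W U) \<in> carrier_mat ?n ?n"
    by (rule mult_carrier_mat[OF c(3,4)])
  fix x y w T S R
  assume T: "(T :: complex mat) \<in> carrier_mat (fst V) (fst V)"
    and S: "weight \<iota> \<chi> W y S" "S \<in> carrier_mat (fst W) (fst W)"
    and R: "weight \<iota> \<chi> U w R" "R \<in> carrier_mat (fst U) (fst U)"
  note rV = reps_carrier[OF V u_closed] and rW = reps_carrier[OF W u_closed]
  note TS = kron_carrier[OF T S(2)] and TSR = kron_carrier[OF kron_carrier[OF T S(2)] R(2)]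
  have uS: "weight \<iota> \<chi> W y (snd W (u w) * S)" by (rule weight_rep_mult[OF W S(1) u_closed])
  have uT: "snd V (u y) * T \<in> carrier_mat (fst V) (fst V)" by (rule mult_carrier_mat[OF rV T])
  have "J (tensor_rep V W) U * kron (J V W) (1\<^sub>m (fst U)) * kron (kron T S) R
      = J (tensor_rep V W) U * (kron (J V W) (1\<^sub>m (fst U)) * kron (kron T S) R)"
    by (rule assoc_mult_mat[OF c(1,2) TSR])
  also have "kron (J V W) (1\<^sub>m (fst U)) * kron (kron T S) R = kron (kron (snd V (u y) * T) S) R"
    using kron_mult[symmetric, OF tensorator_carrier TS one_carrier_mat R(2), of \<iota> \<chi> u] R(2)
    by (simp only: tensorator_kron[OF V W u_closed T S] left_mult_one_mat)
  also have "J (tensor_rep V W) U * \<dots>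
      = kron (snd (tensor_rep V W) (u w) * kron (snd V (u y) * T) S) R"
    by (rule tensorator_kron[OF tensor_reps[OF V W] U u_closed _ R, where m = "fst V * fst W"])
      (simp only: fst_tensor_rep kron_carrier[OF uT S(2)])
  also have "snd (tensor_rep V W) (u w) * kron (snd V (u y) * T) S
      = kron (snd V (u w) * (snd V (u y) * T)) (snd W (u w) * S)"
    unfolding tensor_rep_def snd_conv by (rule kron_mult[symmetric, OF rV uT rW S(2)])
  also have "snd V (u w) * (snd V (u y) * T) = snd V (u (y + w)) * T"
    unfolding add.commute[of y w] u_add reps_mult[OF V u_closed u_closed]
    by (rule assoc_mult_mat[symmetric, OF rV rV T])
  also have "kron (kron (snd V (u (y + w)) * T) (snd W (u w) * S)) R
      = kron (snd V (u (y + w)) * T) (kron (snd W (u w) * S) R)" by (rule kron_assoc)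
  also have "\<dots> = J V (tensor_rep W U) * kron T (kron (snd W (u w) * S) R)"
    by (rule tensorator_kron[symmetric, OF V tensor_reps[OF W U] u_closed T weight_kron[OF W U uS R(1)],
        where n = "fst W * fst U"])
      (simp only: fst_tensor_rep kron_carrier[OF mult_carrier_mat[OF rW S(2)] R(2)])
  also have "kron T (kron (snd W (u w) * S) R) = kron (1\<^sub>m (fst V)) (J W U) * kron T (kron S R)"
    using kron_mult[symmetric, OF one_carrier_mat T tensorator_carrier kron_carrier[OF S(2) R(2)], of \<iota> \<chi> u] T
    by (simp only: tensorator_kron[OF W U u_closed S(2) R] left_mult_one_mat)
  also have "kron T (kron S R) = kron (kron T S) R" by (rule kron_assoc[symmetric])
  also have "J V (tensor_rep W U) * (kron (1\<^sub>m (fst V)) (J W U) * kron (kron T S) R)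
      = J V (tensor_rep W U) * kron (1\<^sub>m (fst V)) (J W U) * kron (kron T S) R"
    by (rule assoc_mult_mat[symmetric, OF c(3,4) TSR])
  finally show "J (tensor_rep V W) U * kron (J V W) (1\<^sub>m (fst U)) * kron (kron T S) R
      = J V (tensor_rep W U) * kron (1\<^sub>m (fst V)) (J W U) * kron (kron T S) R" .
qed

abbreviation unit_rep :: "'a rep" where
  "unit_rep \<equiv> (1, \<lambda>_. 1\<^sub>m 1)"

lemma unit_reps: "unit_rep \<in> reps G"
  by (simp add: reps_def)

lemma weight_unit: "weight \<iota> \<chi> unit_rep 0 (1\<^sub>m 1)"
  by (simp add: weight_def)

lemma tensorator_unit_left:
  assumes V: "V \<in> reps G"
  shows "J unit_rep V = 1\<^sub>m (fst V)"
  using weight_proj_resolution[OF V]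
  by (simp add: tensorator_def kron_one_left resolution_def flip: One_nat_def)

lemma tensorator_unit_right:
  assumes V: "V \<in> reps G"
  shows "J V unit_rep = 1\<^sub>m (fst V)"
proof -
  have "J V unit_rep * kron (1\<^sub>m (fst V)) (1\<^sub>m 1) = kron (snd V (u 0) * 1\<^sub>m (fst V)) (1\<^sub>m 1)"
    by (rule tensorator_kron[OF V unit_reps u_closed one_carrier_mat weight_unit, where n = 1])
      (simp only: fst_conv one_carrier_mat)
  then show ?thesis
    using tensorator_carrier[of \<iota> \<chi> u V "unit_rep"]
    by (simp add: kron_one_right u_zero reps_one[OF V] flip: One_nat_def)
qed

lemma twist_unit:
  assumes g: "g \<in> carrier G"
  shows "snd (twist unit_rep) g = 1\<^sub>m 1"
proof -
  have "snd (twist unit_rep) g * 1\<^sub>m 1 = z g 0 \<cdot>\<^sub>m (snd unit_rep g * 1\<^sub>m 1)"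
    by (rule twist_mult[OF unit_reps weight_unit g])
  then show ?thesis
    using twist_carrier[OF unit_reps g] by (simp add: z_zero[OF g] flip: One_nat_def)
qed

lemma twist_monoidal_equivalence:
  "monoidal_equivalence (Rep G) (Rep H) twist (\<lambda>_ _ S. S) J (1\<^sub>m 1)"
proof -
  interpret C: monoidal_category "Rep G" by (rule monoidal_category_Rep[OF is_monoid])
  interpret D: monoidal_category "Rep H" by (rule monoidal_category_Rep[OF H.is_monoid])
  interpret cat_equivalence "Rep G" "Rep H" twist "\<lambda>_ _ S. S" by (rule twist_equivalence)
  note simps = Rep_simps(1-4,6-10) TenO_Rep fst_twist_rep fst_tensor_rep
  show ?thesis
  proof
    fix V W assume "V \<in> Obj (Rep G)" "W \<in> Obj (Rep G)"
    then show "cat_iso (Rep H) (twist V \<boxtimes>\<^bsub>Rep H\<^esub> twist W) (twist (V \<boxtimes>\<^bsub>Rep G\<^esub> W)) (J V W)"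
      unfolding simps by (rule tensorator_iso)
  next
    fix V W V' W' f h
    assume "V \<in> Obj (Rep G)" "W \<in> Obj (Rep G)" "V' \<in> Obj (Rep G)" "W' \<in> Obj (Rep G)"
      "f \<in> Hom (Rep G) V V'" "h \<in> Hom (Rep G) W W'"
    then show "(f \<boxdot>\<^bsub>Rep G\<^esub> h) \<star>\<^bsub>Rep H\<^esub> J V W = J V' W' \<star>\<^bsub>Rep H\<^esub> (f \<boxdot>\<^bsub>Rep H\<^esub> h)"
      unfolding simps by (rule tensorator_natural)
  next
    show "cat_iso (Rep H) (Unit (Rep H)) (twist (Unit (Rep G))) (1\<^sub>m 1)"
      unfolding simps by (rule cat_iso_Rep_one) (simp_all add: carrier_eq twist_unit del: One_nat_def)
  next
    fix V W U assume a: "V \<in> Obj (Rep G)" "W \<in> Obj (Rep G)" "U \<in> Obj (Rep G)"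
    have l: "1\<^sub>m (fst V * fst W * fst U) * J (tensor_rep V W) U = J (tensor_rep V W) U"
      using tensorator_carrier[of \<iota> \<chi> u "tensor_rep V W" U] by (simp add: mult.assoc)
    have "J V (tensor_rep W U) * kron (1\<^sub>m (fst V)) (J W U)
        \<in> carrier_mat (fst V * (fst W * fst U)) (fst V * (fst W * fst U))"
      using tensorator_carrier[of \<iota> \<chi> u V "tensor_rep W U"]
        kron_carrier[OF one_carrier_mat[of "fst V"] tensorator_carrier[of \<iota> \<chi> u W U]]
      by (simp add: mult_carrier_mat)
    from right_mult_one_mat[OF this] have r: "J V (tensor_rep W U) * kron (1\<^sub>m (fst V)) (J W U) * 1\<^sub>m (fst V * fst W * fst U)
        = J V (tensor_rep W U) * kron (1\<^sub>m (fst V)) (J W U)"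
      by (simp only: mult.assoc)
    show "Assoc (Rep G) V W U \<star>\<^bsub>Rep H\<^esub> J (V \<boxtimes>\<^bsub>Rep G\<^esub> W) U
          \<star>\<^bsub>Rep H\<^esub> (J V W \<boxdot>\<^bsub>Rep H\<^esub> Ident (Rep H) (twist U))
        = J V (W \<boxtimes>\<^bsub>Rep G\<^esub> U) \<star>\<^bsub>Rep H\<^esub> (Ident (Rep H) (twist V) \<boxdot>\<^bsub>Rep H\<^esub> J W U)
          \<star>\<^bsub>Rep H\<^esub> Assoc (Rep H) (twist V) (twist W) (twist U)"
      using a tensorator_assoc[of V W U] unfolding simps l r by blast
  next
    fix V assume "V \<in> Obj (Rep G)"
    then have V: "V \<in> reps G" by (simp add: Rep_simps)
    show "LUnit (Rep G) V \<star>\<^bsub>Rep H\<^esub> J (Unit (Rep G)) V \<star>\<^bsub>Rep H\<^esub> (1\<^sub>m 1 \<boxdot>\<^bsub>Rep H\<^esub> Ident (Rep H) (twist V))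
        = LUnit (Rep H) (twist V)"
      unfolding simps tensorator_unit_left[OF V] kron_one_left by simp
    show "RUnit (Rep G) V \<star>\<^bsub>Rep H\<^esub> J V (Unit (Rep G)) \<star>\<^bsub>Rep H\<^esub> (Ident (Rep H) (twist V) \<boxdot>\<^bsub>Rep H\<^esub> 1\<^sub>m 1)
        = RUnit (Rep H) (twist V)"
      unfolding simps tensorator_unit_right[OF V] kron_one_right by simp
  qed
qed

theorem twist_isocategorical: "isocategorical G H"
  unfolding isocategorical_def using twist_monoidal_equivalence by blast

end

section \<open>Counting subgroups of split and non-split extensions\<close>

definition extension_group ::
  "('k::group_add \<Rightarrow> 'a::ab_group_add \<Rightarrow> 'a) \<Rightarrow> ('k \<Rightarrow> 'k \<Rightarrow> 'a) \<Rightarrow> ('a \<times> 'k) monoid" where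
  "extension_group act \<beta> = \<lparr>carrier = UNIV,
     mult = (\<lambda>(a, k) (b, l). (a + act k b + \<beta> k l, k + l)), one = (0, 0)\<rparr>"

lemma extension_group_simps [simp]:
  "carrier (extension_group act \<beta>) = UNIV"
  "(a, k) \<otimes>\<^bsub>extension_group act \<beta>\<^esub> (b, l) = (a + act k b + \<beta> k l, k + l)"
  "\<one>\<^bsub>extension_group act \<beta>\<^esub> = (0, 0)"
  by (simp_all add: extension_group_def)

text \<open>
  A normalised two-cocycle of \<open>'k\<close> with values in the module \<open>'a\<close>.  The same action with the zero cocycle gives
  the semidirect product.
\<close>
locale extension_cocycle =
  fixes act :: "'k::group_add \<Rightarrow> 'a::ab_group_add \<Rightarrow> 'a" and \<beta> :: "'k \<Rightarrow> 'k \<Rightarrow> 'a"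
  assumes act_add: "act k (a + b) = act k a + act k b"
    and act_zero: "act 0 a = a"
    and act_comp: "act (k + l) a = act k (act l a)"
    and \<beta>_zero: "\<beta> 0 k = 0" "\<beta> k 0 = 0"
    and \<beta>_cocycle: "act k (\<beta> l m) + \<beta> k (l + m) = \<beta> k l + \<beta> (k + l) m"
begin

abbreviation "E \<equiv> extension_group act \<beta>"
abbreviation "E0 \<equiv> extension_group act (\<lambda>_ _. 0)"

lemma act_0 [simp]: "act k 0 = 0"
  using act_add[of k 0 0] by simp

lemma act_diff: "act k (a - b) = act k a - act k b"
  using act_add[of k "a - b" b] by simp

lemma split_cocycle: "extension_cocycle act (\<lambda>_ _. 0)"
  by unfold_locales (simp_all add: act_add act_zero act_comp)

lemma group_E: "group E"
proof (rule groupI)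
  fix x y w :: "'a \<times> 'k"
  obtain a k b l c m where [simp]: "x = (a, k)" "y = (b, l)" "w = (c, m)"
    by (metis surj_pair)
  show "x \<otimes>\<^bsub>E\<^esub> y \<otimes>\<^bsub>E\<^esub> w = x \<otimes>\<^bsub>E\<^esub> (y \<otimes>\<^bsub>E\<^esub> w)"
    using \<beta>_cocycle[of k l m] by (simp add: act_add act_comp add_ac)
  show "\<one>\<^bsub>E\<^esub> \<otimes>\<^bsub>E\<^esub> x = x" by (simp add: act_zero \<beta>_zero)
  show "\<exists>y\<in>carrier E. y \<otimes>\<^bsub>E\<^esub> x = \<one>\<^bsub>E\<^esub>"
    by (rule bexI[of _ "(- act (- k) a - \<beta> (- k) k, - k)"]) simp_all
qed simp_all

lemma subgroup_mult:
  assumes "subgroup S E" "(a, k) \<in> S" "(b, l) \<in> S"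
  shows "(a + act k b + \<beta> k l, k + l) \<in> S"
  using subgroup.m_closed[OF assms] by simp

lemma subgroup_inverse:
  assumes S: "subgroup S E" and a: "(a, k) \<in> S"
  obtains b where "(b, - k) \<in> S" "a + act k b + \<beta> k (- k) = 0"
proof -
  interpret group E by (rule group_E)
  obtain b l where bl: "inv\<^bsub>E\<^esub> (a, k) = (b, l)" by (metis surj_pair)
  have "(a, k) \<otimes>\<^bsub>E\<^esub> (b, l) = (0, 0)" using r_inv[of "(a, k)"] by (simp add: bl)
  then have "a + act k b + \<beta> k l = 0" "l = - k"
    using minus_unique[of k l] by simp_all
  moreover have "(b, l) \<in> S" using subgroup.m_inv_closed[OF S a] by (simp add: bl)
  ultimately show thesis using that by blast
qed

lemma subgroup_kernel_diff:
  assumes S: "subgroup S E" and a: "(a, k) \<in> S" and b: "(b, k) \<in> S"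
  shows "(a - b, 0) \<in> S"
proof -
  obtain c where c: "(c, - k) \<in> S" "b + act k c + \<beta> k (- k) = 0"
    using subgroup_inverse[OF S b] .
  have "act k c + \<beta> k (- k) = - b"
    using minus_unique[of b "act k c + \<beta> k (- k)"] c(2) by (simp add: add.assoc)
  then have e: "a + act k c + \<beta> k (- k) = a - b" by (simp add: add.assoc)
  show ?thesis using subgroup_mult[OF S a c(1)] unfolding e by simp
qed

lemma subgroup_kernel_add:
  assumes S: "subgroup S E" and a: "(a, 0) \<in> S" and b: "(b, k) \<in> S"
  shows "(a + b, k) \<in> S"
  using subgroup_mult[OF S a b] by (simp add: act_zero \<beta>_zero)

text \<open>
  Over each element of the quotient, two elements of an extension differ by an element of the kernel.
  In the product of differences the cocycle cancels, so they live in the split extension.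
\<close>
definition fibre_diff :: "('a \<times> 'k) set \<Rightarrow> ('a \<times> 'k) set \<Rightarrow> ('a \<times> 'k) set" where
  "fibre_diff S R = {(a - b, k) | a b k. (a, k) \<in> S \<and> (b, k) \<in> R}"

text \<open>
  The subgroups of an extension with given intersection with \<open>'a\<close> and given image in \<open>'k\<close> form a fibre of this
  map.  A non-empty fibre is a torsor under a group of one-cocycles that does not depend on the extension
  class.
\<close>
definition kernel_image :: "('a \<times> 'k) set \<Rightarrow> 'a set \<times> 'k set" where
  "kernel_image S = ({a. (a, 0) \<in> S}, snd ` S)"

lemma fibre_diff_subgroup:
  assumes S: "subgroup S E" and R: "subgroup R E"
  shows "subgroup (fibre_diff S R) E0"
proof -
  interpret E0: group E0 by (rule extension_cocycle.group_E[OF split_cocycle])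
  show ?thesis
  proof (rule E0.subgroupI)
    have "(0 - 0, 0) \<in> fibre_diff S R"
      using subgroup.one_closed[OF S] subgroup.one_closed[OF R]
      unfolding fibre_diff_def extension_group_simps by blast
    then show "fibre_diff S R \<noteq> {}" by blast
  next
    fix x assume "x \<in> fibre_diff S R"
    then obtain a b k where x: "x = (a - b, k)" "(a, k) \<in> S" "(b, k) \<in> R"
      by (auto simp: fibre_diff_def)
    obtain a' where a': "(a', - k) \<in> S" "a + act k a' + \<beta> k (- k) = 0"
      using subgroup_inverse[OF S x(2)] .
    obtain b' where b': "(b', - k) \<in> R" "b + act k b' + \<beta> k (- k) = 0"
      using subgroup_inverse[OF R x(3)] .
    have "a + act k a' + \<beta> k (- k) - (b + act k b' + \<beta> k (- k)) = 0" using a'(2) b'(2) by simp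
    then have "x \<otimes>\<^bsub>E0\<^esub> (a' - b', - k) = \<one>\<^bsub>E0\<^esub>"
      by (simp add: x(1) act_diff algebra_simps)
    then have "inv\<^bsub>E0\<^esub> (a' - b', - k) = x" by (intro E0.inv_equality) simp_all
    then have "inv\<^bsub>E0\<^esub> x = (a' - b', - k)" using E0.inv_inv[of "(a' - b', - k)"] by simp
    then show "inv\<^bsub>E0\<^esub> x \<in> fibre_diff S R" using a'(1) b'(1) by (auto simp: fibre_diff_def)
  next
    fix x y assume "x \<in> fibre_diff S R" "y \<in> fibre_diff S R"
    then obtain a b k c d l where x: "x = (a - b, k)" "(a, k) \<in> S" "(b, k) \<in> R"
      and y: "y = (c - d, l)" "(c, l) \<in> S" "(d, l) \<in> R"
      by (auto simp: fibre_diff_def)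
    have "x \<otimes>\<^bsub>E0\<^esub> y = ((a + act k c + \<beta> k l) - (b + act k d + \<beta> k l), k + l)"
      by (simp add: x(1) y(1) act_diff algebra_simps)
    then show "x \<otimes>\<^bsub>E0\<^esub> y \<in> fibre_diff S R"
      using subgroup_mult[OF S x(2) y(2)] subgroup_mult[OF R x(3) y(3)]
      unfolding fibre_diff_def by blast
  qed simp
qed

lemma kernel_image_fibre_diff:
  assumes S: "subgroup S E" and R: "subgroup R E" and eq: "kernel_image R = kernel_image S"
  shows "kernel_image (fibre_diff S R) = kernel_image S"
proof -
  have ker: "(a, 0) \<in> R \<longleftrightarrow> (a, 0) \<in> S" for a using eq by (auto simp: kernel_image_def)
  have prj: "snd ` R = snd ` S" using eq by (simp add: kernel_image_def)
  have zero: "(0, 0) \<in> R" using subgroup.one_closed[OF R] by simp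
  have "(a, 0) \<in> fibre_diff S R \<longleftrightarrow> (a, 0) \<in> S" for a
  proof
    assume "(a, 0) \<in> fibre_diff S R"
    then obtain b c where "a = b - c" "(b, 0) \<in> S" "(c, 0) \<in> R" by (auto simp: fibre_diff_def)
    then show "(a, 0) \<in> S" using subgroup_kernel_diff[OF S] by (simp add: ker)
  next
    assume "(a, 0) \<in> S"
    then have "(a - 0, 0) \<in> fibre_diff S R" using zero unfolding fibre_diff_def by blast
    then show "(a, 0) \<in> fibre_diff S R" by simp
  qed
  moreover have "snd ` fibre_diff S R = snd ` S"
  proof
    show "snd ` fibre_diff S R \<subseteq> snd ` S" by (force simp: fibre_diff_def)
    show "snd ` S \<subseteq> snd ` fibre_diff S R"
    proof
      fix k assume k: "k \<in> snd ` S"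
      then obtain a where a: "(a, k) \<in> S" by auto
      from k prj obtain b where b: "(b, k) \<in> R" by (metis imageE surjective_pairing)
      have "(a - b, k) \<in> fibre_diff S R" using a b by (auto simp: fibre_diff_def)
      then show "k \<in> snd ` fibre_diff S R" by force
    qed
  qed
  ultimately show ?thesis by (simp add: kernel_image_def)
qed

lemma fibre_diff_cancel:
  assumes S: "subgroup S E" and R: "subgroup R E" and eq: "kernel_image R = kernel_image S"
  shows "S = {(d + b, k) | d b k. (d, k) \<in> fibre_diff S R \<and> (b, k) \<in> R}"
proof -
  have ker: "(a, 0) \<in> R \<longleftrightarrow> (a, 0) \<in> S" for a using eq by (auto simp: kernel_image_def)
  have prj: "snd ` R = snd ` S" using eq by (simp add: kernel_image_def)
  have "(a, k) \<in> S \<longleftrightarrow> (\<exists>d b. a = d + b \<and> (d, k) \<in> fibre_diff S R \<and> (b, k) \<in> R)" for a k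
  proof
    assume a: "(a, k) \<in> S"
    then have "k \<in> snd ` R" unfolding prj by force
    then obtain b where b: "(b, k) \<in> R" by auto
    then have "(a - b, k) \<in> fibre_diff S R" using a by (auto simp: fibre_diff_def)
    with b show "\<exists>d b. a = d + b \<and> (d, k) \<in> fibre_diff S R \<and> (b, k) \<in> R"
      by (intro exI[of _ "a - b"] exI[of _ b]) simp
  next
    assume "\<exists>d b. a = d + b \<and> (d, k) \<in> fibre_diff S R \<and> (b, k) \<in> R"
    then obtain b c e where a: "a = (c - e) + b" "(c, k) \<in> S" "(e, k) \<in> R" "(b, k) \<in> R"
      by (auto simp: fibre_diff_def)
    have "(b - e, 0) \<in> S" using subgroup_kernel_diff[OF R a(4,3)] ker by simp
    from subgroup_kernel_add[OF S this a(2)] show "(a, k) \<in> S" by (simp add: a(1) algebra_simps)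
  qed
  then show ?thesis by auto
qed

text \<open>
  Choosing a base point in every non-empty fibre of \<open>kernel_image\<close> and subtracting it embeds the subgroups of
  the extension in those of the semidirect product.  The embedding preserves \<open>kernel_image\<close>, so it misses the
  standard complement: a subgroup over it would be a complement in the non-split extension.
\<close>
theorem nonsplit_num_subgroups_less:
  assumes fin: "finite (UNIV :: ('a \<times> 'k) set)"
    and nonsplit: "\<nexists>\<sigma>. \<forall>k l. \<sigma> (k + l) = \<sigma> k + act k (\<sigma> l) + \<beta> k l"
  shows "num_subgroups E < num_subgroups E0"
proof -
  (* The choice is arbitrary over a pair that belongs to no subgroup; such a pair is never looked up. *)
  define base where "base t = (SOME R. subgroup R E \<and> kernel_image R = t)" for t
  have base: "subgroup (base (kernel_image S)) E" "kernel_image (base (kernel_image S)) = kernel_image S"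
    if "subgroup S E" for S
    using someI[of "\<lambda>R. subgroup R E \<and> kernel_image R = kernel_image S" S] that by (auto simp: base_def)
  define \<Psi> where "\<Psi> S = fibre_diff S (base (kernel_image S))" for S
  have type: "kernel_image (\<Psi> S) = kernel_image S" if "subgroup S E" for S
    using kernel_image_fibre_diff[OF that base[OF that]] by (simp add: \<Psi>_def)
  have inj: "inj_on \<Psi> {S. subgroup S E}"
  proof (rule inj_onI)
    fix S S' assume "S \<in> {S. subgroup S E}" "S' \<in> {S. subgroup S E}" and eq: "\<Psi> S = \<Psi> S'"
    then have S: "subgroup S E" and S': "subgroup S' E" by auto
    have t: "kernel_image S = kernel_image S'" using type[OF S] type[OF S'] eq by simp
    show "S = S'"
      using fibre_diff_cancel[OF S base[OF S]] fibre_diff_cancel[OF S' base[OF S']] eq t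
      unfolding \<Psi>_def by simp
  qed
  let ?D = "range (\<lambda>k. (0, k)) :: ('a \<times> 'k) set"
  have "subgroup ?D E0"
  proof -
    interpret E0: group E0 by (rule extension_cocycle.group_E[OF split_cocycle])
    show ?thesis
    proof (rule E0.subgroupI)
      fix x assume "x \<in> ?D"
      then obtain k where x: "x = (0, k)" by auto
      have "inv\<^bsub>E0\<^esub> x = (0, - k)" by (rule E0.inv_equality) (simp_all add: x)
      then show "inv\<^bsub>E0\<^esub> x \<in> ?D" by simp
    qed auto
  qed
  moreover have "?D \<notin> \<Psi> ` {S. subgroup S E}"
  proof
    assume "?D \<in> \<Psi> ` {S. subgroup S E}"
    then obtain S where S: "subgroup S E" and D: "kernel_image S = kernel_image ?D" using type by force
    have ker: "(a, 0) \<in> S \<longleftrightarrow> a = 0" for a using D by (auto simp: kernel_image_def)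
    have "snd ` S = UNIV" using D by (auto simp: kernel_image_def image_iff)
    then have "\<exists>a. (a, k) \<in> S" for k by (metis UNIV_I imageE surjective_pairing)
    then obtain \<sigma> where \<sigma>: "(\<sigma> k, k) \<in> S" for k by metis
    have uniq: "a = \<sigma> k" if "(a, k) \<in> S" for a k
      using subgroup_kernel_diff[OF S that \<sigma>] by (simp add: ker)
    have "\<sigma> (k + l) = \<sigma> k + act k (\<sigma> l) + \<beta> k l" for k l
      using uniq[OF subgroup_mult[OF S \<sigma> \<sigma>]] by simp
    then show False using nonsplit by blast
  qed
  moreover have "\<Psi> ` {S. subgroup S E} \<subseteq> {S. subgroup S E0}"
    using fibre_diff_subgroup base by (auto simp: \<Psi>_def)
  ultimately have "\<Psi> ` {S. subgroup S E} \<subset> {S. subgroup S E0}" by blast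
  then have "card (\<Psi> ` {S. subgroup S E}) < card {S. subgroup S E0}"
    by (rule psubset_card_mono[rotated]) (rule finite_subset[of _ "Pow UNIV"], use fin in \<open>auto simp del: Pow_UNIV\<close>)
  then show ?thesis by (simp add: num_subgroups_def card_image[OF inj])
qed

end

section \<open>Invariance of subgroup counts under isomorphism\<close>

lemma num_subgroups_le_of_iso:
  assumes G: "group G" and H: "group H" and iso: "G \<cong> H" and fin: "finite (carrier H)"
  shows "num_subgroups G \<le> num_subgroups H"
proof -
  obtain h where h: "h \<in> iso G H" using iso by (auto simp: is_iso_def)
  interpret group_hom G H h
    using G H h by (intro group_hom.intro group_hom_axioms.intro) (auto simp: iso_def)
  have "inj_on (image h) {S. subgroup S G}"
    using h by (intro inj_onI)
      (auto simp: iso_def bij_betw_def dest!: subgroup.subset dest: inj_on_image_eq_iff[THEN iffD1])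
  moreover have "image h ` {S. subgroup S G} \<subseteq> {S. subgroup S H}"
    using subgroup_img_is_subgroup by blast
  moreover have "finite {S. subgroup S H}"
    by (rule finite_subset[of _ "Pow (carrier H)"]) (auto simp: fin dest: subgroup.subset)
  ultimately show ?thesis unfolding num_subgroups_def by (rule card_inj_on_le)
qed

text \<open>
  A group of the same order that contains a copy of \<open>G\<close> is isomorphic to \<open>G\<close>, and isomorphic groups have
  equally many subgroups.
\<close>
lemma num_subgroups_iso_differ:
  assumes G: "group G" and H: "group H" and fin: "finite (carrier G)" "finite (carrier H)"
    and card: "card (carrier G) = card (carrier H)" and less: "num_subgroups H < num_subgroups G"
  shows "num_subgroups_iso G G \<noteq> num_subgroups_iso G H"
proof -
  have "{S. subgroup S H \<and> H\<lparr>carrier := S\<rparr> \<cong> G} = {}"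
  proof (rule equals0I)
    fix S assume "S \<in> {S. subgroup S H \<and> H\<lparr>carrier := S\<rparr> \<cong> G}"
    then have S: "subgroup S H" and iso: "H\<lparr>carrier := S\<rparr> \<cong> G" by auto
    from iso obtain f where "bij_betw f S (carrier G)" by (auto simp: is_iso_def iso_def)
    then have "card S = card (carrier H)" using card by (simp add: bij_betw_same_card)
    then have "S = carrier H"
      using card_subset_eq[OF fin(2) subgroup.subset[OF S]] by simp
    then have "H \<cong> G" using iso by simp
    then have "G \<cong> H" using H by (simp add: group.iso_sym)
    then show False using num_subgroups_le_of_iso[OF G H _ fin(2)] less by simp
  qed
  then have "num_subgroups_iso G H = 0" by (simp only: num_subgroups_iso_def card.empty)
  moreover have "num_subgroups_iso G G > 0"
  proof -
    have "carrier G \<in> {S. subgroup S G \<and> G\<lparr>carrier := S\<rparr> \<cong> G}"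
      using group.subgroup_self[OF G] by (simp add: iso_refl)
    moreover have "finite {S. subgroup S G \<and> G\<lparr>carrier := S\<rparr> \<cong> G}"
      by (rule finite_subset[of _ "Pow (carrier G)"]) (auto simp: fin dest: subgroup.subset)
    ultimately show ?thesis unfolding num_subgroups_iso_def by (auto simp: card_gt_0_iff)
  qed
  ultimately show ?thesis by simp
qed

section \<open>Copies of countable groups on the natural numbers\<close>

definition nat_copy :: "'a::countable monoid \<Rightarrow> nat monoid" where
  "nat_copy G = \<lparr>carrier = to_nat ` carrier G,
     mult = (\<lambda>m n. to_nat (from_nat m \<otimes>\<^bsub>G\<^esub> from_nat n)), one = to_nat \<one>\<^bsub>G\<^esub>\<rparr>"

lemma nat_copy_simps [simp]:
  "carrier (nat_copy G) = to_nat ` carrier G"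
  "to_nat g \<otimes>\<^bsub>nat_copy G\<^esub> to_nat h = to_nat (g \<otimes>\<^bsub>G\<^esub> h)"
  "\<one>\<^bsub>nat_copy G\<^esub> = to_nat \<one>\<^bsub>G\<^esub>"
  by (simp_all add: nat_copy_def)

lemma group_nat_copy:
  assumes "group G"
  shows "group (nat_copy G)"
proof -
  interpret group G by fact
  show ?thesis by (rule groupI) (auto simp: m_assoc intro: l_inv_ex)
qed

lemma nat_copy_iso: "G \<cong> nat_copy G"
  by (rule is_isoI[of to_nat]) (auto simp: iso_def hom_def bij_betw_def)

lemma num_subgroups_nat_copy:
  assumes G: "group G" and fin: "finite (carrier G)"
  shows "num_subgroups (nat_copy G) = num_subgroups G"
  using num_subgroups_le_of_iso[OF G group_nat_copy[OF G] nat_copy_iso]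
    num_subgroups_le_of_iso[OF group_nat_copy[OF G] G group.iso_sym[OF G nat_copy_iso] fin] fin
  by simp

text \<open>
  The data of a twist are transported along the encoding, which avoids composing monoidal equivalences.
\<close>
lemma isocategorical_nat_copy:
  fixes G H :: "'a::countable monoid"
  assumes "monoidal_twist G H \<iota> \<chi> \<gamma> z u \<kappa>"
  shows "isocategorical (nat_copy G) (nat_copy H)"
proof -
  interpret T: monoidal_twist G H \<iota> \<chi> \<gamma> z u \<kappa> by fact
  interpret G': group "nat_copy G" by (rule group_nat_copy[OF T.is_group])
  interpret H': group "nat_copy H" by (rule group_nat_copy[OF T.H.is_group])
  (* The two commutation laws would loop as rewrite rules, so they are confined to the goals that state them. *)
  interpret monoidal_twist "nat_copy G" "nat_copy H" "\<lambda>c. to_nat (\<iota> c)" \<chi>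
    "\<lambda>m n. \<gamma> (from_nat m) (from_nat n)" "\<lambda>m. z (from_nat m)" "\<lambda>y. to_nat (u y)" "\<lambda>m. \<kappa> (from_nat m)"
  proof (unfold_locales, goal_cases)
    case (3 g c) then show ?case by (auto simp: T.\<iota>_central)
  next
    case (22 g y) then show ?case by (auto simp: T.u_commute)
  qed (auto simp: T.\<iota>_add T.\<chi>_add_left T.\<chi>_add_right T.\<chi>_sum_left T.\<chi>_sum_right T.card_dual
      T.carrier_eq T.one_eq T.mult_eq T.\<gamma>_left T.\<gamma>_right T.z_mult T.z_\<iota> T.z_zero T.z_nonzero
      T.u_add T.z_add)
  show ?thesis by (rule twist_isocategorical)
qed

section \<open>Two isocategorical groups of order 64\<close>

instance bit :: finite
proof
  show "finite (UNIV :: bit set)"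
    by (rule finite_subset[of _ "{0, 1}"]) (auto intro: bit.exhaust)
qed

type_synonym plane = "bit \<times> bit"

lemma plane_cases:
  obtains "k = (0, 0)" | "k = (0, 1)" | "k = (1, 0)" | "k = ((1, 1) :: plane)"
  by (metis bit.exhaust surj_pair)

text \<open>
  The symmetric matrix with rows \<open>(0, k2)\<close> and \<open>(k2, k1)\<close>, applied to a vector.  Symmetry is what makes \<open>theta\<close>
  below exist.
\<close>
fun sym_apply :: "plane \<Rightarrow> plane \<Rightarrow> plane" where
  "sym_apply (k1, k2) (a1, a2) = (k2 * a2, k2 * a1 + k1 * a2)"

fun shear :: "plane \<Rightarrow> plane \<times> plane \<Rightarrow> plane \<times> plane" where
  "shear k (a, b) = (a, b + sym_apply k a)"

fun shear_cocycle :: "plane \<Rightarrow> plane \<Rightarrow> plane \<times> plane" where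
  "shear_cocycle (k1, k2) (l1, l2) = ((0, 0), (0, k1 * l1))"

definition bit_sign :: "bit \<Rightarrow> complex" where
  "bit_sign b = (if b = 0 then 1 else - 1)"

fun plane_char :: "plane \<Rightarrow> plane \<Rightarrow> complex" where
  "plane_char (x1, x2) (c1, c2) = bit_sign (x1 * c1 + x2 * c2)"

text \<open>
  The fourth root of unity \<open>\<i>\<close> to the power \<open>q(x)\<close>, where \<open>q(x) = 2 k2 x1 x2 + k1 x2\<^sup>2\<close> is the quadratic form of the
  matrix of \<open>k\<close>, with the bits lifted to 0 and 1.  The polarisation of \<open>q\<close> is twice the bilinear form of that
  matrix, so the defect of additivity is a sign.
\<close>
fun theta :: "plane \<Rightarrow> plane \<Rightarrow> complex" where
  "theta (k1, k2) (x1, x2) = (if k1 * x2 = 1 then \<i> else 1) * bit_sign (k2 * x1 * x2)"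

lemma sym_apply_add:
  "sym_apply k (a + b) = sym_apply k a + sym_apply k b"
  "sym_apply (k + l) a = sym_apply k a + sym_apply l a"
  by (cases k; cases l; cases a; cases b;
      simp only: sym_apply.simps add_Pair distrib_left distrib_right add_ac)+

lemma sym_apply_zero: "sym_apply 0 a = 0" "sym_apply k 0 = 0"
  by (cases a; cases k; simp add: zero_prod_def)+

lemma extension_cocycle_shear: "extension_cocycle shear shear_cocycle"
proof
  fix k l m :: plane and a b :: "plane \<times> plane"
  show "shear k (a + b) = shear k a + shear k b"
    by (cases a; cases b) (simp add: sym_apply_add add_ac)
  show "shear 0 a = a" by (cases a) (simp add: sym_apply_zero)
  show "shear (k + l) a = shear k (shear l a)" by (cases a) (simp add: sym_apply_add add_ac)
  show "shear_cocycle 0 k = 0" "shear_cocycle k 0 = 0"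
    by (cases k; simp add: zero_prod_def)+
  show "shear k (shear_cocycle l m) + shear_cocycle k (l + m)
      = shear_cocycle k l + shear_cocycle (k + l) m"
    by (cases k rule: plane_cases; cases l rule: plane_cases; cases m rule: plane_cases; simp)
qed

abbreviation "split_group \<equiv> extension_group shear (\<lambda>_ _. 0)"
abbreviation "nonsplit_group \<equiv> extension_group shear shear_cocycle"

text \<open>
  In a section, the image of \<open>(1, 0)\<close> has trivial square only if its component \<open>a2\<close> is 1, because of the
  cocycle, and the image of \<open>(0, 1)\<close> has trivial square only if its components \<open>c1\<close> and \<open>c2\<close> vanish.  The two
  images then do not commute.
\<close>
lemma nonsplit_shear:
  "\<nexists>\<sigma>. \<forall>k l. \<sigma> (k + l) = \<sigma> k + shear k (\<sigma> l) + shear_cocycle k l"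
proof
  assume "\<exists>\<sigma>. \<forall>k l. \<sigma> (k + l) = \<sigma> k + shear k (\<sigma> l) + shear_cocycle k l"
  then obtain \<sigma> where \<sigma>: "\<sigma> (k + l) = \<sigma> k + shear k (\<sigma> l) + shear_cocycle k l" for k l by blast
  obtain a1 a2 b1 b2 where a: "\<sigma> (1, 0) = ((a1, a2), (b1, b2))" by (metis surj_pair)
  obtain c1 c2 d1 d2 where c: "\<sigma> (0, 1) = ((c1, c2), (d1, d2))" by (metis surj_pair)
  have "\<sigma> 0 = \<sigma> 0 + \<sigma> 0"
    using \<sigma>[of 0 0] extension_cocycle.act_zero[OF extension_cocycle_shear]
      extension_cocycle.\<beta>_zero(1)[OF extension_cocycle_shear] by (metis add_0_right)
  then have z: "\<sigma> (0, 0) = ((0, 0), (0, 0))" by (metis add_cancel_right_right zero_prod_def)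
  have "a2 = 1"
    using \<sigma>[of "(1, 0)" "(1, 0)"] by (cases a1; cases a2; cases b1; cases b2; simp add: a z)
  have "c1 = 0" "c2 = 0"
    using \<sigma>[of "(0, 1)" "(0, 1)"] by (cases c1; cases c2; cases d1; cases d2; simp add: c z)+
  have "\<sigma> (1, 0) + shear (1, 0) (\<sigma> (0, 1)) = \<sigma> (0, 1) + shear (0, 1) (\<sigma> (1, 0))"
    using \<sigma>[of "(1, 0)" "(0, 1)"] \<sigma>[of "(0, 1)" "(1, 0)"] by (simp flip: zero_prod_def)
  then have "b1 + d1 = d1 + (b1 + 1)" by (simp add: a c \<open>c1 = 0\<close> \<open>c2 = 0\<close> \<open>a2 = 1\<close>)
  then show False by (cases b1; cases d1; simp)
qed

lemma sum_plane: "(\<Sum>x\<in>(UNIV :: plane set). f x) = f (0, 0) + f (0, 1) + f (1, 0) + f (1, 1)"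
proof -
  have U: "(UNIV :: plane set) = {(0, 0), (0, 1), (1, 0), (1, 1)}" by (auto intro: plane_cases)
  show ?thesis unfolding U by (simp add: add.assoc)
qed

lemma plane_char_zero: "plane_char 0 c = 1" "plane_char x 0 = 1"
  by (cases c; cases x; simp add: zero_prod_def bit_sign_def)+

lemma plane_char_add:
  "plane_char (x + y) c = plane_char x c * plane_char y c"
  "plane_char x (c + d) = plane_char x c * plane_char x d"
  by (cases x rule: plane_cases; cases y rule: plane_cases; cases c rule: plane_cases;
      simp add: bit_sign_def)
    (cases x rule: plane_cases; cases d rule: plane_cases; cases c rule: plane_cases;
      simp add: bit_sign_def)

lemma plane_char_sum:
  "x \<noteq> 0 \<Longrightarrow> (\<Sum>c\<in>UNIV. plane_char x c) = 0"
  "c \<noteq> 0 \<Longrightarrow> (\<Sum>x\<in>UNIV. plane_char x c) = 0"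
  by (cases x rule: plane_cases; simp add: sum_plane bit_sign_def zero_prod_def)
    (cases c rule: plane_cases; simp add: sum_plane bit_sign_def zero_prod_def)

text \<open>
  Lifting bits to 0 and 1 is not additive: \<open>k1\<close> and \<open>l1\<close> produce a carry when both are 1, and the carry is the
  cocycle.
\<close>
lemma theta_mult: "theta k x * theta l x = plane_char x (snd (shear_cocycle k l)) * theta (k + l) x"
  by (cases k rule: plane_cases; cases l rule: plane_cases; cases x rule: plane_cases;
      simp add: bit_sign_def)

lemma theta_add: "theta k (x + y) = plane_char x (sym_apply k y) * (theta k x * theta k y)"
  by (cases k rule: plane_cases; cases x rule: plane_cases; cases y rule: plane_cases;
      simp add: bit_sign_def)

lemma theta_zero: "theta 0 x = 1" "theta k 0 = 1" "theta k x \<noteq> 0"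
  by (cases k rule: plane_cases; cases x rule: plane_cases; simp add: zero_prod_def bit_sign_def)+

lemma double_zero: "a + a = (0 :: plane)"
  by (cases a rule: plane_cases; simp add: zero_prod_def)

lemma shear_cocycle_zero: "shear_cocycle 0 k = 0" "shear_cocycle k 0 = 0"
  using extension_cocycle.\<beta>_zero[OF extension_cocycle_shear] by auto

text \<open>
  The central subgroup consists of all \<open>(0, b)\<close>.  The commutator of an element over \<open>k\<close> with \<open>(y, 0)\<close> is the
  image of \<open>y\<close> under the matrix of \<open>k\<close>, and \<open>theta_add\<close> matches it with the defect of additivity of \<open>theta\<close>.
\<close>
lemma monoidal_twist_shear:
  "monoidal_twist split_group nonsplit_group (\<lambda>c. ((0, c), 0)) plane_char
     (\<lambda>g h. snd (shear_cocycle (snd g) (snd h))) (\<lambda>g. theta (snd g))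
     (\<lambda>x. ((x, 0), 0)) (\<lambda>g. sym_apply (snd g))"
proof -
  interpret S: extension_cocycle shear shear_cocycle by (rule extension_cocycle_shear)
  interpret G: group split_group by (rule extension_cocycle.group_E[OF S.split_cocycle])
  interpret H: group nonsplit_group by (rule S.group_E)
  show ?thesis
  proof (unfold_locales, goal_cases)
    case (3 g c) show ?case
      by (cases g; cases "fst g") (simp add: S.act_zero sym_apply_zero add.commute)
  next
    case (13 g h) show ?case
      by (cases g; cases h; cases "shear_cocycle (snd g) (snd h)")
        (cases "snd g"; cases "snd h"; simp add: sym_apply_zero flip: zero_prod_def)
  next
    case (16 g h x) show ?case by (cases g; cases h) (simp add: theta_mult)
  next
    case (22 g y) show ?case
      by (cases g; cases "fst g")
        (simp add: sym_apply_zero double_zero add.commute add.assoc)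
  qed (simp_all add: S.act_zero sym_apply_zero plane_char_zero plane_char_add plane_char_sum
      theta_mult theta_add theta_zero shear_cocycle_zero)
qed

theorem isocategorical_shear: "isocategorical (nat_copy split_group) (nat_copy nonsplit_group)"
  by (rule isocategorical_nat_copy[OF monoidal_twist_shear])

theorem corollary7p8:
  shows "\<not> monoidal_Morita_invariant (\<lambda>G :: nat monoid. num_subgroups G) \<and>
    (\<exists>L :: nat monoid. group L \<and> finite (carrier L) \<and>
       \<not> monoidal_Morita_invariant (\<lambda>G :: nat monoid. num_subgroups_iso L G))"
proof -
  interpret S: extension_cocycle shear shear_cocycle by (rule extension_cocycle_shear)
  let ?G = "nat_copy split_group" and ?H = "nat_copy nonsplit_group"
  have grp: "group split_group" "group nonsplit_group"
    by (rule extension_cocycle.group_E[OF S.split_cocycle], rule S.group_E)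
  then have G: "group ?G" and H: "group ?H" by (simp_all add: group_nat_copy)
  have fin: "finite (carrier ?G)" "finite (carrier ?H)" by simp_all
  have less: "num_subgroups ?H < num_subgroups ?G"
    using S.nonsplit_num_subgroups_less[OF finite nonsplit_shear] grp
    by (simp add: num_subgroups_nat_copy)
  have "num_subgroups_iso ?G ?G \<noteq> num_subgroups_iso ?G ?H"
    by (rule num_subgroups_iso_differ[OF G H fin _ less]) simp
  then show ?thesis
    using G H fin less isocategorical_shear unfolding monoidal_Morita_invariant_def
    by (metis less_irrefl)
qed

end
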